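(* Let $M$ be a smooth connected manifold with $\dim M\ge 3$. Then there exists a spray $S_0$ on $M$, with Jacobi endomorphism $\Phi_0$, such that the projective class of $S_0$ does not contain any Finsler metrizable spray having the same Jacobi endomorphism $\Phi_0$.
   Context: Let $M$ be an $n$-dimensional smooth connected manifold, $TM$ its tangent bundle with induced coordinates $(x^i,y^i)$, and $T_0M=TM\setminus\{0\}$ the tangent bundle with the zero section removed. Let $\mathbb{C}=y^i\frac{\partial}{\partial y^i}$ be the Liouville vector field and $J=\frac{\partial}{\partial y^i}\otimes dx^i$ the tangent structure. "$k$-homogeneous" means positively homogeneous of degree $k$ in the fiber coordinates $y$. For a function $f$ on $T_0M$ and a vector valued $1$-form $L$, $d_Lf=df\circ L$; thus $d_Jf=\frac{\partial f}{\partial y^i}dx^i$. For a vector field $X$, $[X,L]$ denotes the Lie derivative of $L$ along $X$, i.e. $[X,L](Y)=[X,LY]-L[X,Y]$. Spray: a smooth vector field $S$ on $T_0M$ with $JS=\mathbb{C}$ and $[\mathbb{C},S]=S$; locally $S=y^i\frac{\partial}{\partial x^i}-2G^i(x,y)\frac{\partial}{\partial y^i}$ with $G^i$ $2$-homogeneous. Its horizontal projector is $h=\frac12(\mathrm{Id}-[S,J])$, and its Jacobi endomorphism (Riemann curvature) is the vector valued $1$-form $\Phi=(\mathrm{Id}-h)\circ[S,h]$. The projective class of $S_0$ is the set of all sprays $S=S_0-2P\mathbb{C}$ with $P$ a $1$-homogeneous smooth function on $T_0M$ (including $S_0$ itself). Finsler function: a continuous non-negative function $F:TM\to\mathbb{R}$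 such that (i) $F$ is smooth on $T_0M$ and $F(x,y)=0$ if and only if $y=0$; (ii) $F$ is $1$-homogeneous; (iii) the $2$-form $dd_JF^2$ is symplectic on $T_0M$. The geodesic spray of $F$ is the spray $S$ satisfying $i_Sdd_JF^2=-dF^2$ (for a spray this is equivalent to $d_hF^2=0$). A spray is Finsler metrizable if it is the geodesic spray of some Finsler function. *)

theory Defs
  imports "HOL-Analysis.Analysis"
begin

section \<open>Smooth maps and smooth manifolds\<close>

text \<open>\<open>Ck_on\<close> and \<open>smooth_on\<close> are only used on open sets \<open>S\<close> of Euclidean spaces, where they
  are the usual notions of a \<open>C^k\<close> and of a smooth map.\<close>

fun Ck_on :: "nat \<Rightarrow> 'a::euclidean_space set \<Rightarrow> ('a \<Rightarrow> 'b::euclidean_space) \<Rightarrow> bool" where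
  "Ck_on 0 S f \<longleftrightarrow> continuous_on S f"
| "Ck_on (Suc k) S f \<longleftrightarrow>
     (\<forall>x\<in>S. f differentiable (at x)) \<and> (\<forall>v. Ck_on k S (\<lambda>x. frechet_derivative f (at x) v))"

definition smooth_on :: "'a::euclidean_space set \<Rightarrow> ('a \<Rightarrow> 'b::euclidean_space) \<Rightarrow> bool" where
  "smooth_on S f \<longleftrightarrow> (\<forall>k. Ck_on k S f)"

text \<open>A chart is a domain together with a coordinate map; the values of the coordinate map outside
  the domain play no role.\<close>

type_synonym ('p, 'e) chart = "'p set \<times> ('p \<Rightarrow> 'e)"

definition chart_inv :: "('p, 'e) chart \<Rightarrow> 'e \<Rightarrow> 'p" where
  "chart_inv c = inv_into (fst c) (snd c)"

definition chart_image :: "('p, 'e) chart \<Rightarrow> 'e set" where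
  "chart_image c = snd c ` fst c"

text \<open>The Hausdorff and second countability axioms are carried by the sort of \<open>'m\<close>. The manifold is
  the whole type, with its given topology and the smooth structure generated by the atlas.\<close>

definition smooth_manifold ::
  "('m::{t2_space, second_countable_topology}, 'e::euclidean_space) chart set \<Rightarrow> bool" where
  "smooth_manifold A \<longleftrightarrow>
     (\<Union>c\<in>A. fst c) = UNIV \<and>
     (\<forall>c\<in>A. open (fst c) \<and> open (chart_image c) \<and>
        homeomorphism (fst c) (chart_image c) (snd c) (chart_inv c)) \<and>
     (\<forall>c\<in>A. \<forall>c'\<in>A. smooth_on (snd c ` (fst c \<inter> fst c')) (snd c' \<circ> chart_inv c))"


section \<open>Calculus on a manifold given by an atlas\<close>

text \<open>In this section \<open>B\<close> is the atlas of any manifold. It is used for \<open>M\<close>, for \<open>TM\<close> and for the slit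
  tangent bundle.

  A tangent vector at \<open>p\<close> is a family of components, one for every chart around \<open>p\<close>, that transform
  by the derivatives of the transition maps. Components in charts not containing \<open>p\<close> are set to 0,
  so that equality of tangent vectors is equality of families.\<close>

type_synonym ('p, 'e) tvec = "('p, 'e) chart \<Rightarrow> 'e"

definition tangent_space :: "('p, 'e::euclidean_space) chart set \<Rightarrow> 'p \<Rightarrow> ('p, 'e) tvec set" where
  "tangent_space B p =
     {v. (\<forall>c\<in>B. \<forall>c'\<in>B. p \<in> fst c \<longrightarrow> p \<in> fst c' \<longrightarrow>
            v c' = frechet_derivative (snd c' \<circ> chart_inv c) (at (snd c p)) (v c)) \<and>
         (\<forall>c. \<not> (c \<in> B \<and> p \<in> fst c) \<longrightarrow> v c = 0)}"

definition continuous_fun :: "('p, 'e::euclidean_space) chart set \<Rightarrow> ('p \<Rightarrow> real) \<Rightarrow> bool" where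
  "continuous_fun B f \<longleftrightarrow> (\<forall>c\<in>B. continuous_on (chart_image c) (f \<circ> chart_inv c))"

definition smooth_fun :: "('p, 'e::euclidean_space) chart set \<Rightarrow> ('p \<Rightarrow> real) \<Rightarrow> bool" where
  "smooth_fun B f \<longleftrightarrow> (\<forall>c\<in>B. smooth_on (chart_image c) (f \<circ> chart_inv c))"

type_synonym ('p, 'e) vfield = "'p \<Rightarrow> ('p, 'e) tvec"

definition local_rep :: "('p, 'e) vfield \<Rightarrow> ('p, 'e) chart \<Rightarrow> 'e \<Rightarrow> 'e" where
  "local_rep X c = (\<lambda>x. X (chart_inv c x) c)"

definition vector_fields :: "('p, 'e::euclidean_space) chart set \<Rightarrow> ('p, 'e) vfield set" where
  "vector_fields B =
     {X. (\<forall>p\<in>(\<Union>c\<in>B. fst c). X p \<in> tangent_space B p) \<and>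
         (\<forall>c\<in>B. smooth_on (chart_image c) (local_rep X c))}"

definition vf_minus :: "('p, 'e::euclidean_space) vfield \<Rightarrow> ('p, 'e) vfield \<Rightarrow> ('p, 'e) vfield" where
  "vf_minus X Y = (\<lambda>p c. X p c - Y p c)"

definition vf_scale :: "real \<Rightarrow> ('p, 'e::euclidean_space) vfield \<Rightarrow> ('p, 'e) vfield" where
  "vf_scale r X = (\<lambda>p c. r *\<^sub>R X p c)"

text \<open>The function \<open>X(f)\<close>. By the chain rule the chart chosen around \<open>p\<close> is irrelevant.\<close>

definition vf_deriv ::
  "('p, 'e::euclidean_space) chart set \<Rightarrow> ('p, 'e) vfield \<Rightarrow> ('p \<Rightarrow> real) \<Rightarrow> 'p \<Rightarrow> real" where
  "vf_deriv B X f = (\<lambda>p.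
     let c = (SOME c. c \<in> B \<and> p \<in> fst c)
     in frechet_derivative (f \<circ> chart_inv c) (at (snd c p)) (X p c))"

definition bracket ::
  "('p, 'e::euclidean_space) chart set \<Rightarrow> ('p, 'e) vfield \<Rightarrow> ('p, 'e) vfield \<Rightarrow> ('p, 'e) vfield" where
  "bracket B X Y = (\<lambda>p c.
     if c \<in> B \<and> p \<in> fst c
     then frechet_derivative (local_rep Y c) (at (snd c p)) (X p c)
        - frechet_derivative (local_rep X c) (at (snd c p)) (Y p c)
     else 0)"

text \<open>Vector valued 1-forms and scalar forms are represented by their action on smooth vector
  fields.\<close>

type_synonym ('p, 'e) vform = "('p, 'e) vfield \<Rightarrow> ('p, 'e) vfield"
type_synonym ('p, 'e) form1 = "('p, 'e) vfield \<Rightarrow> 'p \<Rightarrow> real"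
type_synonym ('p, 'e) form2 = "('p, 'e) vfield \<Rightarrow> ('p, 'e) vfield \<Rightarrow> 'p \<Rightarrow> real"
type_synonym ('p, 'e) form3 =
  "('p, 'e) vfield \<Rightarrow> ('p, 'e) vfield \<Rightarrow> ('p, 'e) vfield \<Rightarrow> 'p \<Rightarrow> real"

text \<open>\<open>[X,L](Y) = [X,LY] - L[X,Y]\<close>\<close>

definition lie_vform ::
  "('p, 'e::euclidean_space) chart set \<Rightarrow> ('p, 'e) vfield \<Rightarrow> ('p, 'e) vform \<Rightarrow> ('p, 'e) vform" where
  "lie_vform B X L = (\<lambda>Y. vf_minus (bracket B X (L Y)) (L (bracket B X Y)))"

text \<open>\<open>d_L f = df \<circ> L\<close>\<close>

definition d_vform ::
  "('p, 'e::euclidean_space) chart set \<Rightarrow> ('p, 'e) vform \<Rightarrow> ('p \<Rightarrow> real) \<Rightarrow> ('p, 'e) form1" where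
  "d_vform B L f = (\<lambda>Y. vf_deriv B (L Y) f)"

definition ext_d1 ::
  "('p, 'e::euclidean_space) chart set \<Rightarrow> ('p, 'e) form1 \<Rightarrow> ('p, 'e) form2" where
  "ext_d1 B \<alpha> = (\<lambda>X Y p.
     vf_deriv B X (\<alpha> Y) p - vf_deriv B Y (\<alpha> X) p - \<alpha> (bracket B X Y) p)"

definition ext_d2 ::
  "('p, 'e::euclidean_space) chart set \<Rightarrow> ('p, 'e) form2 \<Rightarrow> ('p, 'e) form3" where
  "ext_d2 B \<omega> = (\<lambda>X Y Z p.
     vf_deriv B X (\<omega> Y Z) p + vf_deriv B Y (\<omega> Z X) p + vf_deriv B Z (\<omega> X Y) p
     - \<omega> (bracket B X Y) Z p - \<omega> (bracket B Y Z) X p - \<omega> (bracket B Z X) Y p)"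

text \<open>Closed and nondegenerate. Every tangent vector extends to a smooth vector field, so the
  nondegeneracy below is the pointwise one.\<close>

definition symplectic :: "('p, 'e::euclidean_space) chart set \<Rightarrow> ('p, 'e) form2 \<Rightarrow> bool" where
  "symplectic B \<omega> \<longleftrightarrow>
     (\<forall>X\<in>vector_fields B. \<forall>Y\<in>vector_fields B. \<forall>Z\<in>vector_fields B. \<forall>p\<in>(\<Union>c\<in>B. fst c).
        ext_d2 B \<omega> X Y Z p = 0) \<and>
     (\<forall>X\<in>vector_fields B. \<forall>p\<in>(\<Union>c\<in>B. fst c).
        (\<forall>Y\<in>vector_fields B. \<omega> X Y p = 0) \<longrightarrow> X p = (\<lambda>_. 0))"


section \<open>The tangent bundle\<close>

type_synonym ('p, 'e) tangent = "'p \<times> ('p, 'e) tvec"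

definition tangent_bundle :: "('p, 'e::euclidean_space) chart set \<Rightarrow> ('p, 'e) tangent set" where
  "tangent_bundle A = {(p, v). p \<in> (\<Union>c\<in>A. fst c) \<and> v \<in> tangent_space A p}"

definition slit_bundle :: "('p, 'e::euclidean_space) chart set \<Rightarrow> ('p, 'e) tangent set" where
  "slit_bundle A = {z \<in> tangent_bundle A. snd z \<noteq> (\<lambda>_. 0)}"

text \<open>Induced coordinates \<open>(x,y)\<close>.\<close>

definition tangent_atlas ::
  "('p, 'e::euclidean_space) chart set \<Rightarrow> (('p, 'e) tangent, 'e \<times> 'e) chart set" where
  "tangent_atlas A =
     (\<lambda>c. ({z \<in> tangent_bundle A. fst z \<in> fst c}, \<lambda>z. (snd c (fst z), snd z c))) ` A"

definition slit_atlas ::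
  "('p, 'e::euclidean_space) chart set \<Rightarrow> (('p, 'e) tangent, 'e \<times> 'e) chart set" where
  "slit_atlas A = (\<lambda>k. (fst k \<inter> slit_bundle A, snd k)) ` tangent_atlas A"

definition fibre_scale :: "real \<Rightarrow> ('p, 'e::euclidean_space) tangent \<Rightarrow> ('p, 'e) tangent" where
  "fibre_scale r z = (fst z, \<lambda>c. r *\<^sub>R snd z c)"

text \<open>The Liouville vector field \<open>y^i \<partial>/\<partial>y^i\<close> on the slit tangent bundle.\<close>

definition liouville ::
  "('p, 'e::euclidean_space) chart set \<Rightarrow> (('p, 'e) tangent, 'e \<times> 'e) vfield" where
  "liouville A = (\<lambda>z k. if k \<in> slit_atlas A \<and> z \<in> fst k then (0, snd (snd k z)) else 0)"

text \<open>The tangent structure \<open>\<partial>/\<partial>y^i \<otimes> dx^i\<close>.\<close>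

definition tangent_structure :: "(('p, 'e::euclidean_space) tangent, 'e \<times> 'e) vform" where
  "tangent_structure Y = (\<lambda>z k. (0, fst (Y z k)))"


section \<open>Sprays and Finsler functions\<close>

definition spray ::
  "('p, 'e::euclidean_space) chart set \<Rightarrow> (('p, 'e) tangent, 'e \<times> 'e) vfield \<Rightarrow> bool" where
  "spray A S \<longleftrightarrow>
     S \<in> vector_fields (slit_atlas A) \<and>
     (\<forall>z\<in>slit_bundle A. tangent_structure S z = liouville A z) \<and>
     (\<forall>z\<in>slit_bundle A. bracket (slit_atlas A) (liouville A) S z = S z)"

definition horizontal_projector ::
  "('p, 'e::euclidean_space) chart set \<Rightarrow> (('p, 'e) tangent, 'e \<times> 'e) vfield
    \<Rightarrow> (('p, 'e) tangent, 'e \<times> 'e) vform" where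
  "horizontal_projector A S =
     (\<lambda>Y. vf_scale (1/2) (vf_minus Y (lie_vform (slit_atlas A) S tangent_structure Y)))"

definition jacobi_endomorphism ::
  "('p, 'e::euclidean_space) chart set \<Rightarrow> (('p, 'e) tangent, 'e \<times> 'e) vfield
    \<Rightarrow> (('p, 'e) tangent, 'e \<times> 'e) vform" where
  "jacobi_endomorphism A S =
     (\<lambda>Y. let h = horizontal_projector A S; Z = lie_vform (slit_atlas A) S h Y
          in vf_minus Z (h Z))"

definition same_jacobi_endomorphism ::
  "('p, 'e::euclidean_space) chart set \<Rightarrow> (('p, 'e) tangent, 'e \<times> 'e) vfield
    \<Rightarrow> (('p, 'e) tangent, 'e \<times> 'e) vfield \<Rightarrow> bool" where
  "same_jacobi_endomorphism A S S' \<longleftrightarrow>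
     (\<forall>Y\<in>vector_fields (slit_atlas A). \<forall>z\<in>slit_bundle A.
        jacobi_endomorphism A S Y z = jacobi_endomorphism A S' Y z)"

definition projective_class ::
  "('p, 'e::euclidean_space) chart set \<Rightarrow> (('p, 'e) tangent, 'e \<times> 'e) vfield
    \<Rightarrow> (('p, 'e) tangent, 'e \<times> 'e) vfield set" where
  "projective_class A S\<^sub>0 =
     {S. spray A S \<and>
         (\<exists>P. smooth_fun (slit_atlas A) P \<and>
              (\<forall>z\<in>slit_bundle A. \<forall>r>0. P (fibre_scale r z) = r * P z) \<and>
              (\<forall>z\<in>slit_bundle A. S z = (\<lambda>k. S\<^sub>0 z k - (2 * P z) *\<^sub>R liouville A z k)))}"

text \<open>The 2-form \<open>dd_J F\<^sup>2\<close>.\<close>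

definition ddJ_sq ::
  "('p, 'e::euclidean_space) chart set \<Rightarrow> (('p, 'e) tangent \<Rightarrow> real)
    \<Rightarrow> (('p, 'e) tangent, 'e \<times> 'e) form2" where
  "ddJ_sq A F =
     ext_d1 (slit_atlas A) (d_vform (slit_atlas A) tangent_structure (\<lambda>z. (F z)\<^sup>2))"

definition finsler_function ::
  "('p, 'e::euclidean_space) chart set \<Rightarrow> (('p, 'e) tangent \<Rightarrow> real) \<Rightarrow> bool" where
  "finsler_function A F \<longleftrightarrow>
     continuous_fun (tangent_atlas A) F \<and>
     (\<forall>z\<in>tangent_bundle A. F z \<ge> 0) \<and>
     smooth_fun (slit_atlas A) F \<and>
     (\<forall>z\<in>tangent_bundle A. F z = 0 \<longleftrightarrow> snd z = (\<lambda>_. 0)) \<and>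
     (\<forall>z\<in>tangent_bundle A. \<forall>r>0. F (fibre_scale r z) = r * F z) \<and>
     symplectic (slit_atlas A) (ddJ_sq A F)"

text \<open>\<open>i_S dd_J F\<^sup>2 = - dF\<^sup>2\<close>\<close>

definition geodesic_spray ::
  "('p, 'e::euclidean_space) chart set \<Rightarrow> (('p, 'e) tangent \<Rightarrow> real)
    \<Rightarrow> (('p, 'e) tangent, 'e \<times> 'e) vfield \<Rightarrow> bool" where
  "geodesic_spray A F S \<longleftrightarrow>
     spray A S \<and>
     (\<forall>Y\<in>vector_fields (slit_atlas A). \<forall>z\<in>slit_bundle A.
        ddJ_sq A F S Y z = - vf_deriv (slit_atlas A) Y (\<lambda>z. (F z)\<^sup>2) z)"

definition finsler_metrizable ::
  "('p, 'e::euclidean_space) chart set \<Rightarrow> (('p, 'e) tangent, 'e \<times> 'e) vfield \<Rightarrow> bool" where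
  "finsler_metrizable A S \<longleftrightarrow> (\<exists>F. finsler_function A F \<and> geodesic_spray A F S)"

end

theory Submission
  imports Defs
begin

text \<open>There is a spray none of whose projective deformations is Finsler metrizable. Near a point, in induced coordinates, take
  \<open>G\<^sup>i = x\<^sup>j (y\<^sup>k)\<^sup>2\<close> for three distinct indices \<open>i, j, k\<close> and all other components
  of \<open>G\<close> zero. If \<open>F\<close> metrizes a spray projectively equivalent to \<open>S\<close>, the
  Euler--Lagrange equation of \<open>F\<^sup>2\<close> together with homogeneity gives Rapcsak's equation
  \<open>S(\<partial>F/\<partial>y\<^sup>l) = \<partial>F/\<partial>x\<^sup>l\<close>, in which the projective factor has dropped out. Differentiating it for
  \<open>l = i, j\<close> with respect to \<open>y\<^sup>j, y\<^sup>i\<close> gives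
  \<open>\<partial>\<^sup>2F/\<partial>x\<^sup>j\<partial>y\<^sup>i = \<partial>\<^sup>2F/\<partial>x\<^sup>i\<partial>y\<^sup>j\<close>, and applying \<open>S\<close> to this yields
  \<open>(y\<^sup>k)\<^sup>2 \<partial>\<^sup>2F/\<partial>y\<^sup>i\<partial>y\<^sup>i = 0\<close>. So \<open>F\<close> is affine and positive, hence constant, on the line
  \<open>e\<^sub>k + t e\<^sub>i\<close>, and homogeneity forces \<open>F(e\<^sub>i) = 0\<close>, a contradiction. A partition of unity extends the local
  spray to the whole manifold.\<close>

section \<open>Calculus of smooth maps\<close>

text \<open>The last identity is an instance of a Helmholtz condition: the Jacobi endomorphism Phi
  of a variational spray is self-adjoint for the y-Hessian of \<open>F\<close>. For the chosen
  \<open>G\<close> its only nonzero entries are Phi^i_j = 2 (y^k)^2 and Phi^i_k = - 2 y^j y^k, and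
  self-adjointness between the directions i and j makes the Hessian vanish on e_i. The shape of
  \<open>G\<close> comes from there: it depends on x^j so that Phi sends e_j to a multiple of e_i,
  and in y only on y^k so that nothing else touches the directions i and j. A projective change
  alters Phi only by multiples of the tangent structure and by terms with values in the span of the
  Liouville field, which lies in the kernel of the Hessian of the 1-homogeneous \<open>F\<close>;
  hence one obstruction serves the whole class. One vanishing Hessian entry does not by itself
  contradict nondegeneracy. The contradiction comes from positivity along a whole line in one fibre,
  so the argument is local in x but not in y.\<close>

abbreviation fd :: "('a::euclidean_space \<Rightarrow> 'b::euclidean_space) \<Rightarrow> 'a \<Rightarrow> 'a \<Rightarrow> 'b" where
  "fd f x \<equiv> frechet_derivative f (at x)"

lemma fd_eqI: "(f has_derivative f') (at x) \<Longrightarrow> fd f x = f'"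
  by (metis frechet_derivative_at)

lemma has_fd: "f differentiable (at x) \<Longrightarrow> (f has_derivative fd f x) (at x)"
  by (simp add: frechet_derivative_works)

lemma linear_fd: "f differentiable (at x) \<Longrightarrow> linear (fd f x)"
  by (rule linear_frechet_derivative)

lemma has_derivative_open_cong:
  assumes "open S" "x \<in> S" "\<And>y. y \<in> S \<Longrightarrow> f y = g y"
  shows "(f has_derivative f') (at x) \<longleftrightarrow> (g has_derivative f') (at x)"
  using assms has_derivative_transform_within_open[of f f' x UNIV S g]
    has_derivative_transform_within_open[of g f' x UNIV S f] by auto

lemma fd_cong:
  assumes "open S" "x \<in> S" "\<And>y. y \<in> S \<Longrightarrow> f y = g y"
  shows "fd f x = fd g x"
  unfolding frechet_derivative_def using has_derivative_open_cong[OF assms] by simp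

lemma differentiable_open_cong:
  assumes "open S" "x \<in> S" "\<And>y. y \<in> S \<Longrightarrow> f y = g y"
  shows "f differentiable (at x) \<longleftrightarrow> g differentiable (at x)"
  unfolding differentiable_def using has_derivative_open_cong[OF assms] by simp

section \<open>Closure properties of the classes C^k on open sets\<close>

lemma Ck_on_cong:
  assumes "open S" "\<And>y. y \<in> S \<Longrightarrow> f y = g y"
  shows "Ck_on k S f \<longleftrightarrow> Ck_on k S g"
  using assms(2)
proof (induction k arbitrary: f g)
  case 0 then show ?case by (auto intro: continuous_on_cong)
next
  case (Suc k)
  have "Ck_on k S (\<lambda>x. fd f x v) = Ck_on k S (\<lambda>x. fd g x v)" for v
  proof (rule Suc.IH)
    fix y assume "y \<in> S"
    show "fd f y v = fd g y v" using fd_cong[OF assms(1) \<open>y \<in> S\<close>, of f g] Suc.prems by metis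
  qed
  moreover have "\<And>x. x \<in> S \<Longrightarrow> f differentiable (at x) \<longleftrightarrow> g differentiable (at x)"
    using differentiable_open_cong[OF assms(1), of _ f g] Suc.prems by metis
  ultimately show ?case by simp
qed

lemma Ck_on_subset: "Ck_on k S f \<Longrightarrow> T \<subseteq> S \<Longrightarrow> Ck_on k T f"
  by (induction k arbitrary: f) (auto intro: continuous_on_subset)

lemma Ck_on_Suc_imp: "Ck_on (Suc k) S f \<Longrightarrow> Ck_on k S f"
proof (induction k arbitrary: f)
  case 0 then show ?case
    by (auto intro!: continuous_at_imp_continuous_on differentiable_imp_continuous_within)
next
  case (Suc k) show ?case using Suc.prems Suc.IH by (subst Ck_on.simps) (simp del: Ck_on.simps add: Ck_on.simps(2)[of "Suc k"])
qed

lemma Ck_on_local: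
  assumes "\<And>x. x \<in> S \<Longrightarrow> \<exists>U. open U \<and> x \<in> U \<and> Ck_on k (S \<inter> U) f"
  shows "Ck_on k S f"
  using assms
proof (induction k arbitrary: f)
  case 0
  show ?case unfolding Ck_on.simps continuous_on_eq_continuous_within
  proof
    fix x assume "x \<in> S"
    from 0[OF this] obtain U where U: "open U" "x \<in> U" "continuous_on (S \<inter> U) f" by auto
    then show "continuous (at x within S) f"
      using \<open>x \<in> S\<close> at_within_nhd[of x U S "S \<inter> U"] by (auto simp: continuous_on_eq_continuous_within)
  qed
next
  case (Suc k)
  have "f differentiable (at x)" if "x \<in> S" for x using Suc.prems[OF that] that by auto
  moreover have "Ck_on k S (\<lambda>x. fd f x v)" for v
    by (intro Suc.IH) (metis Suc.prems Ck_on.simps(2))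
  ultimately show ?case by simp
qed

lemma Ck_on_const [simp]: "Ck_on k S (\<lambda>_. c)"
  by (induction k arbitrary: c) (auto simp: frechet_derivative_const)

lemma Ck_on_bounded_linear:
  assumes "bounded_linear f" shows "Ck_on k S f"
proof (cases k)
  case 0 then show ?thesis using assms by (simp add: linear_continuous_on)
next
  case (Suc j)
  have "(f has_derivative f) (at x)" for x using assms by (rule bounded_linear_imp_has_derivative)
  then show ?thesis using Suc fd_eqI[of f f] by (auto simp: differentiable_def)
qed

lemma Ck_on_add:
  assumes "open S" "Ck_on k S f" "Ck_on k S g" shows "Ck_on k S (\<lambda>x. f x + g x)"
  using assms(2,3)
proof (induction k arbitrary: f g)
  case 0 then show ?case by (simp add: continuous_on_add)
next
  case (Suc k)
  have e: "fd (\<lambda>x. f x + g x) x = (\<lambda>v. fd f x v + fd g x v)" if "x \<in> S" for x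
    using Suc.prems that by (intro fd_eqI has_derivative_add has_fd) auto
  have "Ck_on k S (\<lambda>x. fd (\<lambda>x. f x + g x) x v)" for v
    using Suc.prems by (subst Ck_on_cong[OF assms(1), where g="\<lambda>x. fd f x v + fd g x v"]) (auto simp: e intro: Suc.IH)
  then show ?case using Suc.prems by (auto intro: differentiable_add)
qed

text \<open>An arbitrary bounded bilinear map covers products, scalar multiples and inner products
  at once. The induction closes because both Leibniz terms have the same form at lower
  order.\<close>

lemma Ck_on_bilinear:
  assumes p: "bounded_bilinear p"
  assumes "open S" "Ck_on k S f" "Ck_on k S g" shows "Ck_on k S (\<lambda>x. p (f x) (g x))"
  using assms(3,4)
proof (induction k arbitrary: f g)
  case 0 then show ?case using p by (simp add: bounded_bilinear.continuous_on)
next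
  case (Suc k)
  note d = bounded_bilinear.FDERIV[OF p has_fd has_fd]
  have e: "fd (\<lambda>x. p (f x) (g x)) x = (\<lambda>v. p (f x) (fd g x v) + p (fd f x v) (g x))" if "x \<in> S" for x
    using Suc.prems that by (intro fd_eqI d) auto
  have "Ck_on k S (\<lambda>x. p (f x) (fd g x v) + p (fd f x v) (g x))" for v
    using Suc.prems Ck_on_Suc_imp[OF Suc.prems(1)] Ck_on_Suc_imp[OF Suc.prems(2)] by (intro Ck_on_add Suc.IH assms(2)) auto
  then have "Ck_on k S (\<lambda>x. fd (\<lambda>x. p (f x) (g x)) x v)" for v
    by (subst Ck_on_cong[OF assms(2)]) (auto simp: e)
  moreover have "(\<lambda>x. p (f x) (g x)) differentiable (at x)" if "x \<in> S" for x
    by (rule differentiableI[OF d]) (use Suc.prems that in auto)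
  ultimately show ?case by simp
qed

lemma Ck_on_sum:
  assumes "open S" "finite I" "\<And>i. i \<in> I \<Longrightarrow> Ck_on k S (f i)" shows "Ck_on k S (\<lambda>x. \<Sum>i\<in>I. f i x)"
  using assms(2,3) by (induction I rule: finite_induct) (auto intro: Ck_on_add assms(1))

text \<open>\<open>Ck_on\<close> controls derivatives in fixed directions only. This expansion
  reduces a direction that moves with the point to finitely many fixed ones.\<close>

lemma fd_Basis:
  fixes g :: "'a::euclidean_space \<Rightarrow> 'b::euclidean_space"
  assumes "g differentiable (at x)"
  shows "fd g x v = (\<Sum>b\<in>Basis. (v \<bullet> b) *\<^sub>R fd g x b)"
proof -
  have "fd g x (\<Sum>b\<in>Basis. (v \<bullet> b) *\<^sub>R b) = (\<Sum>b\<in>Basis. (v \<bullet> b) *\<^sub>R fd g x b)"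
    using linear_fd[OF assms] by (simp add: linear_sum linear_scale)
  then show ?thesis by (simp add: euclidean_representation)
qed

text \<open>The chain rule evaluates the derivative of \<open>g\<close> in the moving direction
  \<open>fd f x v\<close>; expanded over the basis it is a sum of products in which \<open>g\<close>
  is replaced by its partial derivatives. Hence the induction generalises over \<open>g\<close> and
  keeps \<open>f\<close>.\<close>

lemma Ck_on_compose:
  assumes "open S" "open T" "Ck_on k S f" "Ck_on k T g" "f ` S \<subseteq> T" shows "Ck_on k S (\<lambda>x. g (f x))"
  using assms(3,4,5)
proof (induction k arbitrary: g)
  case 0 then show ?case by (auto intro: continuous_on_compose2)
next
  case (Suc k)
  have df: "f differentiable (at x)" and dg: "g differentiable (at (f x))" if "x \<in> S" for x
    using Suc.prems that by auto
  have h: "((\<lambda>x. g (f x)) has_derivative (\<lambda>v. fd g (f x) (fd f x v))) (at x)" if "x \<in> S" for x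
    by (rule has_derivative_compose[OF has_fd[OF df[OF that]]]) (use has_fd[OF dg[OF that]] in simp)
  have "Ck_on k S (\<lambda>x. \<Sum>b\<in>Basis. (fd f x v \<bullet> b) *\<^sub>R fd g (f x) b)" for v
  proof (intro Ck_on_sum Ck_on_bilinear[OF bounded_bilinear_scaleR] assms(1) Suc.IH)
    show "Ck_on k S (\<lambda>x. fd f x v \<bullet> b)" for b
      using Suc.prems by (intro Ck_on_bilinear[OF bounded_bilinear_inner] assms(1)) auto
  qed (use Suc.prems Ck_on_Suc_imp[of k S] in auto)
  moreover have "fd (\<lambda>x. g (f x)) x v = (\<Sum>b\<in>Basis. (fd f x v \<bullet> b) *\<^sub>R fd g (f x) b)" if "x \<in> S" for x v
    unfolding fd_eqI[OF h[OF that]] by (rule fd_Basis[OF dg[OF that]])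
  ultimately have "Ck_on k S (\<lambda>x. fd (\<lambda>x. g (f x)) x v)" for v
    by (subst Ck_on_cong[OF assms(1), where g="\<lambda>x. \<Sum>b\<in>Basis. (fd f x v \<bullet> b) *\<^sub>R fd g (f x) b"])
  then show ?case using h by (auto simp: differentiable_def)
qed

lemma Ck_on_inverse:
  "Ck_on k (- {0}) (inverse :: real \<Rightarrow> real)"
proof (induction k)
  case 0 then show ?case by (auto intro!: continuous_intros)
next
  case (Suc k)
  have h: "(inverse has_derivative (\<lambda>v. - (inverse x * v * inverse x))) (at x)" if "x \<noteq> 0" for x::real
    using that by (auto intro!: derivative_eq_intros)
  have "Ck_on k (- {0}) (\<lambda>x::real. (- v) * (inverse x * inverse x))" for v
    by (intro Ck_on_bilinear[OF bounded_bilinear_mult] Suc.IH open_Compl) auto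
  then have "Ck_on k (- {0}) (\<lambda>x::real. fd inverse x v)" for v
    by (subst Ck_on_cong) (use fd_eqI[OF h] in \<open>auto simp: algebra_simps\<close>)
  then show ?case using h by (auto simp: differentiable_def)
qed

section \<open>The corresponding rules for smooth maps\<close>

lemma smooth_on_cong: "open S \<Longrightarrow> (\<And>y. y \<in> S \<Longrightarrow> f y = g y) \<Longrightarrow> smooth_on S f \<longleftrightarrow> smooth_on S g"
  unfolding smooth_on_def using Ck_on_cong[of S f g] by simp

lemma smooth_on_eqI: "open S \<Longrightarrow> smooth_on S g \<Longrightarrow> (\<And>y. y \<in> S \<Longrightarrow> f y = g y) \<Longrightarrow> smooth_on S f"
  using smooth_on_cong[of S f g] by simp

lemma smooth_on_subset: "smooth_on S f \<Longrightarrow> T \<subseteq> S \<Longrightarrow> smooth_on T f"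
  unfolding smooth_on_def using Ck_on_subset by blast

lemma smooth_on_local:
  assumes "\<And>x. x \<in> S \<Longrightarrow> \<exists>U. open U \<and> x \<in> U \<and> smooth_on (S \<inter> U) f"
  shows "smooth_on S f"
  using assms unfolding smooth_on_def by (meson Ck_on_local)

lemma smooth_on_differentiable: "smooth_on S f \<Longrightarrow> x \<in> S \<Longrightarrow> f differentiable (at x)"
  unfolding smooth_on_def by (meson Ck_on.simps(2))

lemma smooth_on_has_fd: "smooth_on S f \<Longrightarrow> x \<in> S \<Longrightarrow> (f has_derivative fd f x) (at x)"
  by (intro has_fd smooth_on_differentiable)

lemma smooth_on_linear_fd: "smooth_on S f \<Longrightarrow> x \<in> S \<Longrightarrow> linear (fd f x)"
  by (intro linear_fd smooth_on_differentiable)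

lemma smooth_on_fd: "smooth_on S f \<Longrightarrow> smooth_on S (\<lambda>x. fd f x v)"
  unfolding smooth_on_def by (metis Ck_on.simps(2))

lemma smooth_on_imp_continuous_on: "smooth_on S f \<Longrightarrow> continuous_on S f"
  unfolding smooth_on_def by (metis Ck_on.simps(1))

lemma smooth_on_const [simp]: "smooth_on S (\<lambda>_. c)"
  by (simp add: smooth_on_def)

lemma smooth_on_bounded_linear: "bounded_linear f \<Longrightarrow> smooth_on S f"
  by (simp add: smooth_on_def Ck_on_bounded_linear)

lemma smooth_on_add: "open S \<Longrightarrow> smooth_on S f \<Longrightarrow> smooth_on S g \<Longrightarrow> smooth_on S (\<lambda>x. f x + g x)"
  by (simp add: smooth_on_def Ck_on_add)

lemma smooth_on_bilinear:
  "bounded_bilinear p \<Longrightarrow> open S \<Longrightarrow> smooth_on S f \<Longrightarrow> smooth_on S g \<Longrightarrow> smooth_on S (\<lambda>x. p (f x) (g x))"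
  by (simp add: smooth_on_def Ck_on_bilinear)

lemmas smooth_on_scaleR = smooth_on_bilinear[OF bounded_bilinear_scaleR]
lemmas smooth_on_mult = smooth_on_bilinear[OF bounded_bilinear_mult]
lemmas smooth_on_inner = smooth_on_bilinear[OF bounded_bilinear_inner]

lemma smooth_on_sum:
  "open S \<Longrightarrow> finite I \<Longrightarrow> (\<And>i. i \<in> I \<Longrightarrow> smooth_on S (f i)) \<Longrightarrow> smooth_on S (\<lambda>x. \<Sum>i\<in>I. f i x)"
  by (simp add: smooth_on_def Ck_on_sum)

lemma smooth_on_compose:
  "open S \<Longrightarrow> open T \<Longrightarrow> smooth_on S f \<Longrightarrow> smooth_on T g \<Longrightarrow> f ` S \<subseteq> T \<Longrightarrow> smooth_on S (\<lambda>x. g (f x))"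
  unfolding smooth_on_def using Ck_on_compose[of S T _ f g] by blast

lemma smooth_on_linear_compose:
  assumes "bounded_linear g" "open S" "smooth_on S f" shows "smooth_on S (\<lambda>x. g (f x))"
  by (rule smooth_on_compose[OF assms(2) open_UNIV assms(3) smooth_on_bounded_linear[OF assms(1)]]) simp

lemma smooth_on_minus: "open S \<Longrightarrow> smooth_on S f \<Longrightarrow> smooth_on S (\<lambda>x. - f x)"
  by (rule smooth_on_linear_compose[OF bounded_linear_minus[OF bounded_linear_ident]])

lemma smooth_on_diff:
  assumes "open S" "smooth_on S f" "smooth_on S g" shows "smooth_on S (\<lambda>x. f x - g x)"
  using smooth_on_add[OF assms(1,2) smooth_on_minus[OF assms(1,3)]] by simp

lemma smooth_on_Pair:
  assumes "open S" "smooth_on S f" "smooth_on S g" shows "smooth_on S (\<lambda>x. (f x, g x))"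
proof -
  have "smooth_on S (\<lambda>x. (f x, 0) + (0, g x))"
    by (intro smooth_on_add assms smooth_on_linear_compose[where g="\<lambda>x. (x, 0)"]
      smooth_on_linear_compose[where g="\<lambda>x. (0, x)"]) (auto intro: bounded_linear_intros)
  then show ?thesis by simp
qed

lemma smooth_on_fst: "open S \<Longrightarrow> smooth_on S f \<Longrightarrow> smooth_on S (\<lambda>x. fst (f x))"
  by (rule smooth_on_linear_compose[OF bounded_linear_fst])

lemma smooth_on_id: "smooth_on S (\<lambda>x. x)"
  by (rule smooth_on_bounded_linear) (rule bounded_linear_ident)

lemma smooth_on_inverse:
  assumes "open S" "smooth_on S f" "\<And>x. x \<in> S \<Longrightarrow> f x \<noteq> (0::real)" shows "smooth_on S (\<lambda>x. inverse (f x))"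
  by (rule smooth_on_compose[OF assms(1) _ assms(2), of "- {0}"])
    (use assms(3) Ck_on_inverse in \<open>auto simp: smooth_on_def\<close>)

lemma smooth_on_fd_compose:
  assumes S: "open S" and T: "open T" and f: "smooth_on T f" and U: "smooth_on S U" and V: "smooth_on S V" "U ` S \<subseteq> T"
  shows "smooth_on S (\<lambda>x. fd f (U x) (V x))"
proof -
  have "smooth_on S (\<lambda>x. \<Sum>b\<in>Basis. (V x \<bullet> b) *\<^sub>R fd f (U x) b)"
    by (intro smooth_on_sum smooth_on_scaleR smooth_on_inner S V smooth_on_const
      smooth_on_compose[OF S T U smooth_on_fd[OF f]]) auto
  moreover have "fd f (U x) (V x) = (\<Sum>b\<in>Basis. (V x \<bullet> b) *\<^sub>R fd f (U x) b)" if "x \<in> S" for x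
    using V(2) that by (intro fd_Basis smooth_on_differentiable[OF f]) auto
  ultimately show ?thesis
    using smooth_on_cong[OF S, of "\<lambda>x. fd f (U x) (V x)" "\<lambda>x. \<Sum>b\<in>Basis. (V x \<bullet> b) *\<^sub>R fd f (U x) b"] by metis
qed

lemma smooth_on_fd_field:
  "open S \<Longrightarrow> smooth_on S f \<Longrightarrow> smooth_on S V \<Longrightarrow> smooth_on S (\<lambda>x. fd f x (V x))"
  using smooth_on_fd_compose[of S S f "\<lambda>x. x" V] smooth_on_id by auto

section \<open>Symmetry of second derivatives\<close>

lemma has_real_derivative_along_line:
  fixes f :: "'a::euclidean_space \<Rightarrow> real"
  assumes "f differentiable (at (x + s *\<^sub>R u))"
  shows "((\<lambda>s. f (x + s *\<^sub>R u)) has_real_derivative fd f (x + s *\<^sub>R u) u) (at s)"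
proof -
  have "((\<lambda>s. f (x + s *\<^sub>R u)) has_derivative (\<lambda>t. fd f (x + s *\<^sub>R u) (t *\<^sub>R u))) (at s)"
    by (rule has_derivative_compose[where f="\<lambda>s. x + s *\<^sub>R u", OF _ has_fd[OF assms]]) (auto intro!: derivative_eq_intros)
  moreover have "fd f (x + s *\<^sub>R u) (t *\<^sub>R u) = fd f (x + s *\<^sub>R u) u * t" for t
    using linear_fd[OF assms] by (simp add: linear_scale)
  ultimately show ?thesis by (simp add: has_field_derivative_def)
qed

text \<open>The mean value theorem is applied to the increment in direction \<open>v\<close> as a
  function of the step along \<open>u\<close>, and then to the derivative in direction
  \<open>u\<close> along \<open>v\<close>. The second difference is symmetric in \<open>u\<close>
  and \<open>v\<close>, which is the source of Schwarz's theorem.\<close>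

lemma second_difference_mvt:
  fixes f :: "'a::euclidean_space \<Rightarrow> real"
  assumes f: "smooth_on S f" and h: "h > 0"
    and S: "\<And>s t. 0 \<le> s \<Longrightarrow> s \<le> h \<Longrightarrow> 0 \<le> t \<Longrightarrow> t \<le> h \<Longrightarrow> x + s *\<^sub>R u + t *\<^sub>R v \<in> S"
  shows "\<exists>s t. 0 \<le> s \<and> s \<le> h \<and> 0 \<le> t \<and> t \<le> h \<and>
    f (x + h *\<^sub>R u + h *\<^sub>R v) - f (x + h *\<^sub>R u) - f (x + h *\<^sub>R v) + f x
     = h * h * fd (\<lambda>y. fd f y u) (x + s *\<^sub>R u + t *\<^sub>R v) v"
proof -
  have D: "f differentiable (at (x + s *\<^sub>R u + t *\<^sub>R v))" "(\<lambda>y. fd f y u) differentiable (at (x + s *\<^sub>R u + t *\<^sub>R v))"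
    if "0 \<le> s" "s \<le> h" "0 \<le> t" "t \<le> h" for s t
    using smooth_on_differentiable[OF f S[OF that]] smooth_on_differentiable[OF smooth_on_fd[OF f] S[OF that]] by auto
  have "((\<lambda>s. f (x + h *\<^sub>R v + s *\<^sub>R u) - f (x + s *\<^sub>R u)) has_real_derivative
      fd f (x + h *\<^sub>R v + s *\<^sub>R u) u - fd f (x + s *\<^sub>R u) u) (at s)" if "0 \<le> s" "s \<le> h" for s
    using D(1)[of s h] D(1)[of s 0] that h
    by (intro DERIV_diff has_real_derivative_along_line) (auto simp: algebra_simps)
  from MVT2[OF h this] obtain s where s: "0 < s" "s < h"
    "f (x + h *\<^sub>R v + h *\<^sub>R u) - f (x + h *\<^sub>R u) - (f (x + h *\<^sub>R v) - f x)
      = h * (fd f (x + h *\<^sub>R v + s *\<^sub>R u) u - fd f (x + s *\<^sub>R u) u)" by auto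
  have "((\<lambda>t. fd f (x + s *\<^sub>R u + t *\<^sub>R v) u) has_real_derivative
      fd (\<lambda>y. fd f y u) (x + s *\<^sub>R u + t *\<^sub>R v) v) (at t)" if "0 \<le> t" "t \<le> h" for t
    using D(2)[of s t] s that by (intro has_real_derivative_along_line[where f="\<lambda>y. fd f y u"]) auto
  from MVT2[OF h this] obtain t where t: "0 < t" "t < h"
    "fd f (x + s *\<^sub>R u + h *\<^sub>R v) u - fd f (x + s *\<^sub>R u) u = h * fd (\<lambda>y. fd f y u) (x + s *\<^sub>R u + t *\<^sub>R v) v" by auto
  show ?thesis
  proof (intro exI conjI)
    show "f (x + h *\<^sub>R u + h *\<^sub>R v) - f (x + h *\<^sub>R u) - f (x + h *\<^sub>R v) + f x
     = h * h * fd (\<lambda>y. fd f y u) (x + s *\<^sub>R u + t *\<^sub>R v) v"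
      using s(3) t(3) by (simp add: algebra_simps)
  qed (use s t in auto)
qed

lemma fd_fd_commute_real:
  fixes f :: "'a::euclidean_space \<Rightarrow> real"
  assumes S: "open S" "x \<in> S" and f: "smooth_on S f"
  shows "fd (\<lambda>y. fd f y u) x v = fd (\<lambda>y. fd f y v) x u"
proof (rule ccontr)
  define A where "A y = fd (\<lambda>y. fd f y u) y v" for y
  define B where "B y = fd (\<lambda>y. fd f y v) y u" for y
  assume "\<not> ?thesis"
  then have e: "\<bar>A x - B x\<bar> / 2 > 0" (is "?e > 0") by (simp add: A_def B_def)
  have "smooth_on S A" "smooth_on S B" unfolding A_def B_def by (intro smooth_on_fd f)+
  then have "isCont A x" "isCont B x"
    using S by (auto dest!: smooth_on_imp_continuous_on simp: continuous_on_eq_continuous_at)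
  then obtain d1 d2 where d: "d1 > 0" "d2 > 0" "\<And>y. dist y x < d1 \<Longrightarrow> dist (A y) (A x) < ?e"
    "\<And>y. dist y x < d2 \<Longrightarrow> dist (B y) (B x) < ?e"
    using e unfolding continuous_at_eps_delta by metis
  obtain d3 where d3: "d3 > 0" "ball x d3 \<subseteq> S" using S open_contains_ball by blast
  define d where "d = min d1 (min d2 d3)"
  \<comment> \<open>The summand 1 keeps the denominator positive when \<open>u\<close> and
    \<open>v\<close> vanish; the parallelogram with sides \<open>h *\<^sub>R u\<close> and
    \<open>h *\<^sub>R v\<close> stays within distance \<open>d\<close> of \<open>x\<close>.\<close>
  define h where "h = d / (norm u + norm v + 1)"
  have d0: "d > 0" using d d3 by (simp add: d_def)
  then have h0: "h > 0" unfolding h_def by (intro divide_pos_pos) (auto intro: add_nonneg_pos)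
  have hd: "h * (norm u + norm v) < d"
  proof -
    have "h * (norm u + norm v + 1) = d" using norm_ge_zero[of u] norm_ge_zero[of v] by (simp add: h_def add_nonneg_eq_0_iff)
    then show ?thesis using h0 by (simp add: algebra_simps)
  qed
  have near: "dist (x + s *\<^sub>R u + t *\<^sub>R v) x < d" if "0 \<le> s" "s \<le> h" "0 \<le> t" "t \<le> h" for s t
  proof -
    have "dist (x + s *\<^sub>R u + t *\<^sub>R v) x \<le> norm (s *\<^sub>R u) + norm (t *\<^sub>R v)"
      by (simp add: dist_norm add.assoc) (metis norm_scaleR norm_triangle_ineq)
    also have "\<dots> \<le> h * norm u + h * norm v" using that by (intro add_mono) (auto intro: mult_right_mono)
    finally show ?thesis using hd by (simp add: algebra_simps)
  qed
  have inS: "x + s *\<^sub>R u + t *\<^sub>R v \<in> S" if "0 \<le> s" "s \<le> h" "0 \<le> t" "t \<le> h" for s t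
    using near[OF that] d3 by (auto simp: d_def dist_commute)
  have inS': "x + s *\<^sub>R v + t *\<^sub>R u \<in> S" if "0 \<le> s" "s \<le> h" "0 \<le> t" "t \<le> h" for s t
    using inS[of t s] that by (simp add: algebra_simps)
  obtain s t where st: "0 \<le> s" "s \<le> h" "0 \<le> t" "t \<le> h"
    "f (x + h *\<^sub>R u + h *\<^sub>R v) - f (x + h *\<^sub>R u) - f (x + h *\<^sub>R v) + f x = h * h * A (x + s *\<^sub>R u + t *\<^sub>R v)"
    using second_difference_mvt[OF f h0 inS] unfolding A_def by blast
  obtain s' t' where st': "0 \<le> s'" "s' \<le> h" "0 \<le> t'" "t' \<le> h"
    "f (x + h *\<^sub>R v + h *\<^sub>R u) - f (x + h *\<^sub>R v) - f (x + h *\<^sub>R u) + f x = h * h * B (x + s' *\<^sub>R v + t' *\<^sub>R u)"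
    using second_difference_mvt[OF f h0 inS'] unfolding B_def by blast
  \<comment> \<open>Both sides are the same second difference, read once with \<open>u\<close> first
    and once with \<open>v\<close> first.\<close>
  have "h * h * A (x + s *\<^sub>R u + t *\<^sub>R v) = h * h * B (x + t' *\<^sub>R u + s' *\<^sub>R v)"
    using st(5) st'(5) by (simp add: algebra_simps)
  then have eq: "A (x + s *\<^sub>R u + t *\<^sub>R v) = B (x + t' *\<^sub>R u + s' *\<^sub>R v)" using h0 by simp
  have "dist (A (x + s *\<^sub>R u + t *\<^sub>R v)) (A x) < ?e"
    by (rule d(3)) (use near[OF st(1-4)] in \<open>simp add: d_def\<close>)
  moreover have "dist (B (x + t' *\<^sub>R u + s' *\<^sub>R v)) (B x) < ?e"
    by (rule d(4)) (use near[OF st'(3,4,1,2)] in \<open>simp add: d_def\<close>)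
  ultimately have "dist (A x) (B x) < ?e + ?e"
    using eq by (metis dist_commute dist_triangle_less_add)
  then show False by (simp add: dist_real_def)
qed

lemma fd_inner:
  assumes "f differentiable (at x)" shows "fd (\<lambda>y. f y \<bullet> b) x = (\<lambda>v. fd f x v \<bullet> b)"
  by (rule fd_eqI) (rule has_derivative_inner_left[OF has_fd[OF assms]])

lemma fd_fd_commute:
  fixes f :: "'a::euclidean_space \<Rightarrow> 'b::euclidean_space"
  assumes S: "open S" "x \<in> S" and f: "smooth_on S f"
  shows "fd (\<lambda>y. fd f y u) x v = fd (\<lambda>y. fd f y v) x u"
proof (rule euclidean_eqI)
  fix b :: 'b assume "b \<in> Basis"
  have fb: "smooth_on S (\<lambda>y. f y \<bullet> b)" by (intro smooth_on_inner S f smooth_on_const)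
  have e: "fd (\<lambda>y. fd f y w) x w' \<bullet> b = fd (\<lambda>y. fd (\<lambda>y. f y \<bullet> b) y w) x w'" for w w'
  proof -
    have "fd (\<lambda>y. fd f y w) x w' \<bullet> b = fd (\<lambda>y. fd f y w \<bullet> b) x w'"
      unfolding fd_inner[OF smooth_on_differentiable[OF smooth_on_fd[OF f] S(2)], of w b] by (rule refl)
    also have "fd (\<lambda>y. fd f y w \<bullet> b) x = fd (\<lambda>y. fd (\<lambda>y. f y \<bullet> b) y w) x"
    proof (rule fd_cong[OF S])
      fix y assume "y \<in> S"
      then show "fd f y w \<bullet> b = fd (\<lambda>y. f y \<bullet> b) y w"
        unfolding fd_inner[OF smooth_on_differentiable[OF f \<open>y \<in> S\<close>]] by simp
    qed
    finally show ?thesis .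
  qed
  show "fd (\<lambda>y. fd f y u) x v \<bullet> b = fd (\<lambda>y. fd f y v) x u \<bullet> b"
    unfolding e by (rule fd_fd_commute_real[OF S fb])
qed

text \<open>Over the basis \<open>fd f y (Y y)\<close> is a sum of products, and Leibniz separates
  the variation of the derivative of \<open>f\<close>, with the field frozen at \<open>Y x\<close>,
  from the variation of the field.\<close>

lemma fd_fd_field:
  assumes S: "open S" "x \<in> S" and f: "smooth_on S f" and Y: "smooth_on S Y"
  shows "fd (\<lambda>y. fd f y (Y y)) x v = fd (\<lambda>y. fd f y (Y x)) x v + fd f x (fd Y x v)"
proof -
  have D: "((\<lambda>y. fd f y b) has_derivative fd (\<lambda>y. fd f y b) x) (at x)" for b
    by (rule smooth_on_has_fd[OF smooth_on_fd[OF f] S(2)])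
  have L: "linear (fd f x)" by (rule smooth_on_linear_fd[OF f S(2)])
  have "((\<lambda>y. \<Sum>b\<in>Basis. (Y y \<bullet> b) *\<^sub>R fd f y b) has_derivative
      (\<lambda>v. \<Sum>b\<in>Basis. (Y x \<bullet> b) *\<^sub>R fd (\<lambda>y. fd f y b) x v + (fd Y x v \<bullet> b) *\<^sub>R fd f x b)) (at x)"
    by (intro has_derivative_sum has_derivative_scaleR has_derivative_inner_left D smooth_on_has_fd[OF Y S(2)])
  moreover have "fd (\<lambda>y. fd f y (Y y)) x = fd (\<lambda>y. \<Sum>b\<in>Basis. (Y y \<bullet> b) *\<^sub>R fd f y b) x"
    by (rule fd_cong[OF S]) (rule fd_Basis[OF smooth_on_differentiable[OF f]])
  ultimately have 1: "fd (\<lambda>y. fd f y (Y y)) x v =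
     (\<Sum>b\<in>Basis. (Y x \<bullet> b) *\<^sub>R fd (\<lambda>y. fd f y b) x v) + (\<Sum>b\<in>Basis. (fd Y x v \<bullet> b) *\<^sub>R fd f x b)"
    by (simp add: fd_eqI sum.distrib)
  have "((\<lambda>y. \<Sum>b\<in>Basis. (Y x \<bullet> b) *\<^sub>R fd f y b) has_derivative
      (\<lambda>v. \<Sum>b\<in>Basis. (Y x \<bullet> b) *\<^sub>R fd (\<lambda>y. fd f y b) x v)) (at x)"
    by (intro has_derivative_sum has_derivative_scaleR_right D)
  moreover have "fd (\<lambda>y. fd f y (Y x)) x = fd (\<lambda>y. \<Sum>b\<in>Basis. (Y x \<bullet> b) *\<^sub>R fd f y b) x"
    by (rule fd_cong[OF S]) (rule fd_Basis[OF smooth_on_differentiable[OF f]])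
  ultimately have 2: "fd (\<lambda>y. fd f y (Y x)) x v = (\<Sum>b\<in>Basis. (Y x \<bullet> b) *\<^sub>R fd (\<lambda>y. fd f y b) x v)"
    by (simp add: fd_eqI)
  show ?thesis
    unfolding 1 2 using fd_Basis[OF smooth_on_differentiable[OF f S(2)], of "fd Y x v"] by simp
qed

text \<open>The second derivatives of \<open>f\<close> cancel by symmetry and only first derivatives
  of the fields remain. With \<open>f\<close> a transition map this is the invariance of the Lie
  bracket under a change of coordinates.\<close>

lemma fd_field_commute:
  assumes S: "open S" "x \<in> S" and f: "smooth_on S f" and "smooth_on S X" "smooth_on S Y"
  shows "fd (\<lambda>y. fd f y (Y y)) x (X x) - fd (\<lambda>y. fd f y (X y)) x (Y x) = fd f x (fd Y x (X x) - fd X x (Y x))"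
  using fd_fd_field[OF S f assms(4), of "Y x"] fd_fd_field[OF S f assms(5), of "X x"]
    fd_fd_commute[OF S f, of "X x" "Y x"] linear_diff[OF smooth_on_linear_fd[OF f S(2)]] by simp

section \<open>Smooth bump functions\<close>

text \<open>The powers of \<open>1/t\<close> make the family closed under differentiation.\<close>

definition flat_exp :: "nat \<Rightarrow> real \<Rightarrow> real" where
  "flat_exp n t = (if t > 0 then inverse t ^ n * exp (- inverse t) else 0)"

lemma flat_exp_deriv:
  "(flat_exp n has_real_derivative flat_exp (n + 2) t - n * flat_exp (n + 1) t) (at t)"
proof -
  consider "t > 0" | "t < 0" | "t = 0" by linarith
  then show ?thesis
  proof cases
    case 1
    have "((\<lambda>t. inverse t ^ n * exp (- inverse t)) has_real_derivative
        inverse t ^ n * (exp (- inverse t) * (inverse t * inverse t)) 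
        + (n * (- (inverse t * inverse t)) * inverse t ^ (n - 1)) * exp (- inverse t)) (at t)"
      using 1 by (auto intro!: derivative_eq_intros simp: algebra_simps power2_eq_square)
    \<comment> \<open>For \<open>n = 0\<close> the truncated exponent \<open>n - 1\<close> is
      harmless because of the factor \<open>n\<close>.\<close>
    moreover have "inverse t ^ n * (exp (- inverse t) * (inverse t * inverse t)) 
        + (n * (- (inverse t * inverse t)) * inverse t ^ (n - 1)) * exp (- inverse t)
        = flat_exp (n + 2) t - n * flat_exp (n + 1) t"
      using 1 by (cases n) (auto simp: flat_exp_def algebra_simps)
    ultimately have "((\<lambda>t. inverse t ^ n * exp (- inverse t)) has_real_derivative flat_exp (n + 2) t - n * flat_exp (n + 1) t) (at t)" by simp
    then show ?thesis
      by (rule has_field_derivative_transform_within_open[where S="{0<..}"]) (use 1 in \<open>auto simp: flat_exp_def\<close>)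
  next
    case 2
    have "((\<lambda>t. 0) has_real_derivative 0) (at t)" by simp
    then have "(flat_exp n has_real_derivative 0) (at t)"
      by (rule has_field_derivative_transform_within_open[where S="{..<0}"]) (use 2 in \<open>auto simp: flat_exp_def\<close>)
    then show ?thesis using 2 by (simp add: flat_exp_def)
  next
    case 3
    \<comment> \<open>At 0 from the right the difference quotient is a power of 1/t times exp
      (-1/t); with s = 1/t this is the decay of s^(n+1) / exp s.\<close>
    have "((\<lambda>s::real. s ^ (n + 1) / exp s) \<longlongrightarrow> 0) at_top" by (rule tendsto_power_div_exp_0)
    then have "((\<lambda>t::real. inverse t ^ (n + 1) / exp (inverse t)) \<longlongrightarrow> 0) (at_right 0)"
      by (rule filterlim_compose[OF _ filterlim_inverse_at_top_right])
    then have R: "((\<lambda>t. flat_exp n t / t) \<longlongrightarrow> 0) (at_right 0)"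
      by (rule Lim_transform_eventually)
        (auto simp: eventually_at_right_less flat_exp_def exp_minus divide_inverse eventually_at_filter)
    have "((\<lambda>t. flat_exp n t / t) \<longlongrightarrow> 0) (at_left 0)"
      by (rule Lim_transform_eventually[of "\<lambda>_. 0"]) (auto simp: flat_exp_def eventually_at_filter)
    with R have "((\<lambda>t. flat_exp n t / t) \<longlongrightarrow> 0) (at 0)" by (simp add: filterlim_split_at)
    then show ?thesis using 3 by (simp add: has_field_derivative_iff flat_exp_def)
  qed
qed

lemma Ck_on_flat_exp: "Ck_on k UNIV (flat_exp n)"
proof (induction k arbitrary: n)
  case 0 show ?case
    using flat_exp_deriv by (auto intro!: continuous_at_imp_continuous_on intro: DERIV_isCont)
next
  case (Suc k)
  have h: "(flat_exp n has_derivative (\<lambda>v. (flat_exp (n + 2) x - n * flat_exp (n + 1) x) * v)) (at x)" for x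
    using flat_exp_deriv[of n x] by (simp add: has_field_derivative_def)
  have "Ck_on k UNIV (\<lambda>x. (flat_exp (n + 2) x + (- real n) * flat_exp (n + 1) x) * v)" for v
    by (intro Ck_on_bilinear[OF bounded_bilinear_mult] Ck_on_add Suc.IH) auto
  then show ?case using h by (auto simp: differentiable_def fd_eqI[OF h])
qed

lemma smooth_bump:
  fixes a :: "'a::euclidean_space"
  assumes "r > 0"
  obtains \<beta> :: "'a \<Rightarrow> real" where "smooth_on UNIV \<beta>" "\<And>x. x \<in> cball a r \<Longrightarrow> \<beta> x = 1" "\<And>x. x \<notin> ball a (2 * r) \<Longrightarrow> \<beta> x = 0"
proof
  define s :: "'a \<Rightarrow> real" where "s x = ((x - a) \<bullet> (x - a)) * inverse (r * r)" for x
  define g where "g = flat_exp 0"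
  have s_norm: "s x = (dist a x / r)\<^sup>2" for x
    by (simp add: s_def power2_norm_eq_inner[symmetric] dist_norm norm_minus_commute power_divide power2_eq_square divide_inverse)
  have g: "smooth_on UNIV (g::real\<Rightarrow>real)" by (simp add: smooth_on_def g_def Ck_on_flat_exp)
  have gpos: "g t \<ge> 0" "t > 0 \<Longrightarrow> g t > 0" "t \<le> 0 \<Longrightarrow> g t = 0" for t by (auto simp: g_def flat_exp_def)
  have den: "g (2 - s x) + g (s x - 1) > 0" for x
    using gpos(1)[of "2 - s x"] gpos(1)[of "s x - 1"] gpos(2)[of "2 - s x"] gpos(2)[of "s x - 1"] by force
  \<comment> \<open>\<open>2 - s x\<close> and \<open>s x - 1\<close> add up to 1, so at least one
    of them is positive and the denominator never vanishes. \<open>s\<close> is the squared relative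
    distance, which is smooth also at the centre; it is at most 1 on the inner ball and at least 4
    outside the outer one.\<close>
  let ?\<beta> = "\<lambda>x. g (2 - s x) * inverse (g (2 - s x) + g (s x - 1))"
  have s: "smooth_on UNIV s"
    unfolding s_def by (intro smooth_on_mult smooth_on_inner smooth_on_diff smooth_on_id) auto
  have "smooth_on UNIV (\<lambda>x. g (2 - s x))" "smooth_on UNIV (\<lambda>x. g (s x - 1))"
    by (rule smooth_on_compose[OF open_UNIV open_UNIV _ g], intro smooth_on_diff s smooth_on_const open_UNIV, simp)+
  then show "smooth_on UNIV ?\<beta>"
    using den by (intro smooth_on_mult smooth_on_inverse smooth_on_add) (auto simp: less_imp_neq[symmetric] less_imp_neq)
  show "?\<beta> x = 1" if "x \<in> cball a r" for x
  proof -
    have "dist a x / r \<le> 1" using that assms by simp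
    then have "s x \<le> 1" using assms by (auto simp: s_norm intro!: power_le_one)
    then show ?thesis using gpos(3)[of "s x - 1"] den[of x] by simp
  qed
  show "?\<beta> x = 0" if "x \<notin> ball a (2 * r)" for x
  proof -
    have "2 \<le> dist a x / r" using that assms by (simp add: pos_le_divide_eq)
    then have "2\<^sup>2 \<le> s x" unfolding s_norm by (intro power_mono) auto
    then show ?thesis using gpos(3)[of "2 - s x"] by simp
  qed
qed

section \<open>Tangent vectors and vector fields\<close>

abbreviation transition :: "('p, 'e) chart \<Rightarrow> ('p, 'e) chart \<Rightarrow> 'e \<Rightarrow> 'e" where
  "transition k k' \<equiv> snd k' \<circ> chart_inv k"

text \<open>Openness is read off through the charts because the type \<open>'p\<close> carries no
  topology here; this is how the slit bundle gets its topology. Points of \<open>W\<close> outside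
  all charts are ignored, so preimages of sets of the base need not be intersected with the
  bundle.\<close>

definition open_in_atlas :: "('p, 'e::euclidean_space) chart set \<Rightarrow> 'p set \<Rightarrow> bool" where
  "open_in_atlas B W \<longleftrightarrow> (\<forall>k\<in>B. open (snd k ` (fst k \<inter> W)))"

text \<open>Instantiated twice, for the manifold and for its slit tangent bundle, so that tangent
  vectors, cutoffs and brackets are treated once. The charts need not cover the whole type, since
  the slit bundle does not.\<close>

locale smooth_atlas =
  fixes B :: "('p, 'e::euclidean_space) chart set"
  assumes inj_chart: "k \<in> B \<Longrightarrow> inj_on (snd k) (fst k)"
    and open_domain: "k \<in> B \<Longrightarrow> open_in_atlas B (fst k)"
    and smooth_transition: "k \<in> B \<Longrightarrow> k' \<in> B \<Longrightarrow> smooth_on (snd k ` (fst k \<inter> fst k')) (transition k k')"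
begin

lemma chart_inv_chart [simp]: "k \<in> B \<Longrightarrow> z \<in> fst k \<Longrightarrow> chart_inv k (snd k z) = z"
  by (simp add: chart_inv_def inj_chart)

lemma open_overlap: "k \<in> B \<Longrightarrow> k' \<in> B \<Longrightarrow> open (snd k ` (fst k \<inter> fst k'))"
  using open_domain by (auto simp: open_in_atlas_def)

lemma open_chart_image: "k \<in> B \<Longrightarrow> open (chart_image k)"
  using open_overlap[of k k] by (simp add: chart_image_def)

lemma chart_image_cases:
  assumes "k \<in> B" "w \<in> chart_image k"
  obtains z where "z \<in> fst k" "w = snd k z" "chart_inv k w = z"
  using assms by (auto simp: chart_image_def)

lemma transition_deriv:
  assumes "k \<in> B" "k' \<in> B" "z \<in> fst k" "z \<in> fst k'"
  shows "(transition k k' has_derivative fd (transition k k') (snd k z)) (at (snd k z))"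
  by (rule smooth_on_has_fd[OF smooth_transition]) (use assms in auto)

lemma linear_transition_deriv:
  assumes "k \<in> B" "k' \<in> B" "z \<in> fst k" "z \<in> fst k'"
  shows "linear (fd (transition k k') (snd k z))"
  using has_derivative_linear[OF transition_deriv[OF assms]] .

text \<open>Near \<open>z\<close> the expression of \<open>f\<close> in \<open>k\<close> is its
  expression in \<open>k'\<close> after the transition map, so the chain rule applies.
  \<open>f\<close> may take values in any Euclidean space: for a coordinate map in its place this is
  the cocycle law.\<close>

lemma chart_change_deriv:
  assumes "k \<in> B" "k' \<in> B" "z \<in> fst k" "z \<in> fst k'" "(f \<circ> chart_inv k') differentiable (at (snd k' z))"
  shows "(f \<circ> chart_inv k) differentiable (at (snd k z))"
    and "fd (f \<circ> chart_inv k) (snd k z) v = fd (f \<circ> chart_inv k') (snd k' z) (fd (transition k k') (snd k z) v)"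
proof -
  have "((\<lambda>w. (f \<circ> chart_inv k') (transition k k' w)) has_derivative
      (\<lambda>v. fd (f \<circ> chart_inv k') (snd k' z) (fd (transition k k') (snd k z) v))) (at (snd k z))"
    using has_derivative_compose[OF transition_deriv[OF assms(1-4)], of "f \<circ> chart_inv k'"] has_fd[OF assms(5)] assms(1,3) by simp
  then have h: "((f \<circ> chart_inv k) has_derivative
      (\<lambda>v. fd (f \<circ> chart_inv k') (snd k' z) (fd (transition k k') (snd k z) v))) (at (snd k z))"
    by (rule has_derivative_transform_within_open[OF _ open_overlap[OF assms(1,2)]]) (use assms in auto)
  show "(f \<circ> chart_inv k) differentiable (at (snd k z))" using h by (auto simp: differentiable_def)
  show "fd (f \<circ> chart_inv k) (snd k z) v = fd (f \<circ> chart_inv k') (snd k' z) (fd (transition k k') (snd k z) v)"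
    by (simp add: fd_eqI[OF h])
qed

lemma transition_cocycle:
  assumes "k \<in> B" "k' \<in> B" "k'' \<in> B" "z \<in> fst k" "z \<in> fst k'" "z \<in> fst k''"
  shows "fd (transition k k'') (snd k z) v = fd (transition k' k'') (snd k' z) (fd (transition k k') (snd k z) v)"
  using transition_deriv[of k' k'' z] assms
  by (intro chart_change_deriv(2)) (auto simp: differentiable_def)

lemma transition_self:
  assumes "k \<in> B" "z \<in> fst k"
  shows "fd (transition k k) (snd k z) v = v"
proof -
  have "(transition k k has_derivative (\<lambda>v. v)) (at (snd k z))"
    by (rule has_derivative_transform_within_open[OF has_derivative_ident open_chart_image[OF assms(1)]])
      (use assms in \<open>auto simp: chart_image_def\<close>)
  from fd_eqI[OF this] show ?thesis by simp
qed

section \<open>Tangent spaces as vector spaces\<close>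

lemma tangent_spaceD:
  assumes "v \<in> tangent_space B z" "k \<in> B" "k' \<in> B" "z \<in> fst k" "z \<in> fst k'"
  shows "v k' = fd (transition k k') (snd k z) (v k)"
  using assms unfolding tangent_space_def by blast

lemma tangent_spaceI:
  assumes "\<And>k k'. k \<in> B \<Longrightarrow> k' \<in> B \<Longrightarrow> z \<in> fst k \<Longrightarrow> z \<in> fst k' \<Longrightarrow> v k' = fd (transition k k') (snd k z) (v k)"
    and "\<And>k. \<not> (k \<in> B \<and> z \<in> fst k) \<Longrightarrow> v k = 0"
  shows "v \<in> tangent_space B z"
  using assms unfolding tangent_space_def by blast

lemma tangent_space_outside:
  assumes "v \<in> tangent_space B z" "\<not> (k \<in> B \<and> z \<in> fst k)"
  shows "v k = 0"
  using assms unfolding tangent_space_def by blast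

lemma tangent_space_eqI:
  assumes "v \<in> tangent_space B z" "v' \<in> tangent_space B z" "k \<in> B" "z \<in> fst k" "v k = v' k"
  shows "v = v'"
proof
  fix k' show "v k' = v' k'"
  proof (cases "k' \<in> B \<and> z \<in> fst k'")
    case True
    then show ?thesis
      using tangent_spaceD[OF assms(1,3), of k'] tangent_spaceD[OF assms(2,3), of k'] assms(4,5) by simp
  next
    case False
    then show ?thesis
      using tangent_space_outside[OF assms(1) False] tangent_space_outside[OF assms(2) False] by simp
  qed
qed

lemma tangent_space_zero: "(\<lambda>_. 0) \<in> tangent_space B z"
  by (rule tangent_spaceI) (simp_all add: linear_0[OF linear_transition_deriv])

lemma tangent_space_add:
  assumes "v \<in> tangent_space B z" "v' \<in> tangent_space B z" shows "(\<lambda>k. v k + v' k) \<in> tangent_space B z"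
proof (rule tangent_spaceI)
  fix k k' assume k: "k \<in> B" "k' \<in> B" "z \<in> fst k" "z \<in> fst k'"
  show "v k' + v' k' = fd (transition k k') (snd k z) (v k + v' k)"
    unfolding linear_add[OF linear_transition_deriv[OF k]] tangent_spaceD[OF assms(1) k] tangent_spaceD[OF assms(2) k] ..
qed (metis tangent_space_outside assms add.right_neutral)

lemma tangent_space_scale:
  assumes "v \<in> tangent_space B z" shows "(\<lambda>k. r *\<^sub>R v k) \<in> tangent_space B z"
proof (rule tangent_spaceI)
  fix k k' assume k: "k \<in> B" "k' \<in> B" "z \<in> fst k" "z \<in> fst k'"
  show "r *\<^sub>R v k' = fd (transition k k') (snd k z) (r *\<^sub>R v k)"
    unfolding linear_scale[OF linear_transition_deriv[OF k]] tangent_spaceD[OF assms(1) k] ..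
qed (metis tangent_space_outside assms scaleR_zero_right)

lemma tangent_space_sum:
  "finite I \<Longrightarrow> (\<And>i. i \<in> I \<Longrightarrow> v i \<in> tangent_space B z) \<Longrightarrow> (\<lambda>k. \<Sum>i\<in>I. v i k) \<in> tangent_space B z"
  by (induction I rule: finite_induct) (auto intro: tangent_space_zero tangent_space_add)

text \<open>The compatibility of these components is the cocycle law of the transition derivatives;
  the value 0 elsewhere is the convention of \<open>tangent_space\<close>.\<close>

definition tangent_extension :: "('p, 'e) chart \<Rightarrow> 'p \<Rightarrow> 'e \<Rightarrow> ('p, 'e) tvec" where
  "tangent_extension k0 z u = (\<lambda>k. if k \<in> B \<and> z \<in> fst k then fd (transition k0 k) (snd k0 z) u else 0)"

lemma tangent_extension:
  assumes "k0 \<in> B" "z \<in> fst k0"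
  shows "tangent_extension k0 z u \<in> tangent_space B z" "tangent_extension k0 z u k0 = u"
proof -
  show "tangent_extension k0 z u \<in> tangent_space B z"
  proof (rule tangent_spaceI)
    fix k k' assume k: "k \<in> B" "k' \<in> B" "z \<in> fst k" "z \<in> fst k'"
    show "tangent_extension k0 z u k' = fd (transition k k') (snd k z) (tangent_extension k0 z u k)"
      using transition_cocycle[OF assms(1) k(1,2) assms(2) k(3,4), of u] k by (simp add: tangent_extension_def)
  qed (auto simp: tangent_extension_def)
  show "tangent_extension k0 z u k0 = u"
    using assms transition_self[OF assms] by (simp add: tangent_extension_def)
qed

text \<open>\<open>vf_deriv\<close> evaluates in a chart picked by \<open>SOME\<close>. Passing to
  another chart, the chain rule moves the derivative of the transition map from the function to the
  vector, where the transformation law absorbs it.\<close>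

lemma vf_deriv_chart:
  assumes "k \<in> B" "z \<in> fst k" "X z \<in> tangent_space B z" "(f \<circ> chart_inv k) differentiable (at (snd k z))"
  shows "vf_deriv B X f z = fd (f \<circ> chart_inv k) (snd k z) (X z k)"
proof -
  define c where "c = (SOME c. c \<in> B \<and> z \<in> fst c)"
  have c: "c \<in> B \<and> z \<in> fst c" unfolding c_def by (rule someI[of _ k]) (use assms in auto)
  have "vf_deriv B X f z = fd (f \<circ> chart_inv c) (snd c z) (X z c)"
    by (simp add: vf_deriv_def c_def[symmetric] Let_def)
  also have "\<dots> = fd (f \<circ> chart_inv k) (snd k z) (fd (transition c k) (snd c z) (X z c))"
    using c assms by (intro chart_change_deriv(2)) auto
  also have "\<dots> = fd (f \<circ> chart_inv k) (snd k z) (X z k)"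
    using tangent_spaceD[OF assms(3), of c k] c assms by simp
  finally show ?thesis .
qed

lemma open_image_Int:
  assumes "k \<in> B" "open_in_atlas B W" shows "open (snd k ` (fst k \<inter> W))"
  using assms by (simp add: open_in_atlas_def)

lemma smooth_on_chart_local:
  assumes k: "k \<in> B"
    and "\<And>z. z \<in> fst k \<Longrightarrow> \<exists>W. open_in_atlas B W \<and> z \<in> W \<and> smooth_on (snd k ` (fst k \<inter> W)) g"
  shows "smooth_on (chart_image k) g"
proof (rule smooth_on_local)
  fix w assume "w \<in> chart_image k"
  then obtain z where z: "z \<in> fst k" "w = snd k z" by (auto simp: chart_image_def)
  obtain W where W: "open_in_atlas B W" "z \<in> W" "smooth_on (snd k ` (fst k \<inter> W)) g" using assms(2)[OF z(1)] by auto
  then show "\<exists>U. open U \<and> w \<in> U \<and> smooth_on (chart_image k \<inter> U) g"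
    using open_image_Int[OF k W(1)] z by (intro exI[of _ "snd k ` (fst k \<inter> W)"]) (auto intro: smooth_on_subset)
qed

section \<open>Smooth functions, vector fields supported in one chart, and their sums\<close>

lemma smooth_funD: "smooth_fun B f \<Longrightarrow> k \<in> B \<Longrightarrow> smooth_on (chart_image k) (f \<circ> chart_inv k)"
  by (simp add: smooth_fun_def)

lemma smooth_fun_diff: "smooth_fun B f \<Longrightarrow> smooth_fun B g \<Longrightarrow> smooth_fun B (\<lambda>z. f z - g z)"
  by (auto simp: smooth_fun_def comp_def intro!: smooth_on_diff open_chart_image)

lemma smooth_fun_mult: "smooth_fun B f \<Longrightarrow> smooth_fun B g \<Longrightarrow> smooth_fun B (\<lambda>z. f z * g z)"
  by (auto simp: smooth_fun_def comp_def intro!: smooth_on_mult open_chart_image)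

lemma smooth_fun_const: "smooth_fun B (\<lambda>z. c)"
  by (auto simp: smooth_fun_def comp_def)

lemma smooth_fun_prod:
  "finite I \<Longrightarrow> (\<And>i. i \<in> I \<Longrightarrow> smooth_fun B (f i)) \<Longrightarrow> smooth_fun B (\<lambda>z. \<Prod>i\<in>I. f i z)"
  by (induction I rule: finite_induct) (auto intro: smooth_fun_const smooth_fun_mult)

definition cutoff_field :: "('p, 'e) chart \<Rightarrow> ('p \<Rightarrow> real) \<Rightarrow> ('e \<Rightarrow> 'e) \<Rightarrow> ('p, 'e) vfield" where
  "cutoff_field k0 \<rho> V = (\<lambda>z k. \<rho> z *\<^sub>R tangent_extension k0 z (V (snd k0 z)) k)"

text \<open>\<open>K\<close> stands for the support, closed in the sense of the atlas. The domain of
  \<open>k0\<close> and the complement of \<open>K\<close> are open and cover every chart; on the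
  first the field is an explicit smooth expression, on the second it is zero.\<close>

lemma cutoff_field:
  assumes k0: "k0 \<in> B" and V: "smooth_on (chart_image k0) V" and \<rho>: "smooth_fun B \<rho>"
    and K: "K \<subseteq> fst k0" "open_in_atlas B (- K)" "\<And>k z. k \<in> B \<Longrightarrow> z \<in> fst k \<Longrightarrow> z \<notin> K \<Longrightarrow> \<rho> z = 0"
  shows "cutoff_field k0 \<rho> V \<in> vector_fields B"
proof -
  have T: "cutoff_field k0 \<rho> V z \<in> tangent_space B z" if "k \<in> B" "z \<in> fst k" for z k
  proof (cases "z \<in> K")
    case True
    then show ?thesis unfolding cutoff_field_def using K k0 by (intro tangent_space_scale tangent_extension) auto
  next
    case False
    then show ?thesis unfolding cutoff_field_def using K(3)[OF that False] tangent_space_zero by simp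
  qed
  have "smooth_on (chart_image k) (local_rep (cutoff_field k0 \<rho> V) k)" if k: "k \<in> B" for k
  proof (rule smooth_on_chart_local[OF k])
    fix z assume z: "z \<in> fst k"
    show "\<exists>W. open_in_atlas B W \<and> z \<in> W \<and> smooth_on (snd k ` (fst k \<inter> W)) (local_rep (cutoff_field k0 \<rho> V) k)"
    proof (cases "z \<in> fst k0")
      case True
      let ?U = "snd k ` (fst k \<inter> fst k0)"
      let ?R = "\<lambda>w. (\<rho> \<circ> chart_inv k) w *\<^sub>R fd (transition k0 k) (transition k k0 w) (V (transition k k0 w))"
      have sub: "?U \<subseteq> chart_image k" by (auto simp: chart_image_def)
      have 1: "smooth_on ?U (\<rho> \<circ> chart_inv k)"
        using smooth_on_subset[OF smooth_funD[OF \<rho> k] sub] .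
      have 2: "smooth_on ?U (\<lambda>w. V (transition k k0 w))"
        by (rule smooth_on_compose[OF open_overlap[OF k k0] open_chart_image[OF k0] smooth_transition[OF k k0] V])
          (use k in \<open>auto simp: chart_image_def\<close>)
      have 3: "smooth_on ?U (\<lambda>w. fd (transition k0 k) (transition k k0 w) (V (transition k k0 w)))"
        by (rule smooth_on_fd_compose[OF open_overlap[OF k k0] open_overlap[OF k0 k] smooth_transition[OF k0 k] smooth_transition[OF k k0] 2])
          (use k in auto)
      have "smooth_on ?U ?R" by (rule smooth_on_scaleR[OF open_overlap[OF k k0] 1 3])
      moreover have "local_rep (cutoff_field k0 \<rho> V) k w = ?R w" if "w \<in> ?U" for w
        using that k by (auto simp: local_rep_def cutoff_field_def tangent_extension_def)
      ultimately have "smooth_on ?U (local_rep (cutoff_field k0 \<rho> V) k)"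
        by (rule smooth_on_eqI[OF open_overlap[OF k k0]])
      then show ?thesis using True open_domain[OF k0] by blast
    next
      case False
      have o: "open (snd k ` (fst k \<inter> - K))" using open_image_Int[OF k K(2)] .
      have "local_rep (cutoff_field k0 \<rho> V) k w = 0" if "w \<in> snd k ` (fst k \<inter> - K)" for w
        using that k K(3)[OF k] by (auto simp: local_rep_def cutoff_field_def)
      then have "smooth_on (snd k ` (fst k \<inter> - K)) (local_rep (cutoff_field k0 \<rho> V) k)"
        by (rule smooth_on_eqI[OF o smooth_on_const])
      then show ?thesis using False K by blast
    qed
  qed
  then show ?thesis using T unfolding vector_fields_def by blast
qed

lemma cutoff_field_chart:
  assumes "k0 \<in> B" "z \<in> fst k0" shows "cutoff_field k0 \<rho> V z k0 = \<rho> z *\<^sub>R V (snd k0 z)"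
  using tangent_extension(2)[OF assms] by (simp add: cutoff_field_def)

lemma vector_fields_tangent: "X \<in> vector_fields B \<Longrightarrow> k \<in> B \<Longrightarrow> z \<in> fst k \<Longrightarrow> X z \<in> tangent_space B z"
  unfolding vector_fields_def by blast

lemma vector_fields_smooth: "X \<in> vector_fields B \<Longrightarrow> k \<in> B \<Longrightarrow> smooth_on (chart_image k) (local_rep X k)"
  unfolding vector_fields_def by blast

text \<open>The sum is 0 where infinitely many terms are nonzero; it is used for locally finite families.\<close>

definition total_field :: "('i \<Rightarrow> ('p, 'e) vfield) \<Rightarrow> ('p, 'e) vfield" where
  "total_field X = (\<lambda>z k. \<Sum>j | X j z k \<noteq> 0. X j z k)"

lemma total_field_eq:
  assumes "\<And>j. j \<notin> J \<Longrightarrow> X j z = (\<lambda>_. 0)" "finite J"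
  shows "total_field X z = (\<lambda>k. \<Sum>j\<in>J. X j z k)"
proof
  fix k
  show "total_field X z k = (\<Sum>j\<in>J. X j z k)"
    unfolding total_field_def using assms(1) by (intro sum.mono_neutral_left assms(2)) (auto, metis)
qed

lemma total_field:
  assumes X: "\<And>j. X j \<in> vector_fields B"
    and fin: "\<And>z. z \<in> (\<Union>k\<in>B. fst k) \<Longrightarrow> \<exists>W J. open_in_atlas B W \<and> z \<in> W \<and> finite J \<and> (\<forall>z'\<in>W. \<forall>j. j \<notin> J \<longrightarrow> X j z' = (\<lambda>_. 0))"
  shows "total_field X \<in> vector_fields B"
proof -
  have "total_field X z \<in> tangent_space B z" if "k \<in> B" "z \<in> fst k" for z k
  proof -
    have "z \<in> (\<Union>k\<in>B. fst k)" using that by auto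
    from fin[OF this] obtain W J where W: "z \<in> W" and J: "finite J" "\<forall>z'\<in>W. \<forall>j. j \<notin> J \<longrightarrow> X j z' = (\<lambda>_. 0)"
      by (elim exE conjE)
    have "total_field X z = (\<lambda>k. \<Sum>j\<in>J. X j z k)"
      by (rule total_field_eq[OF _ J(1)]) (use J(2) W in simp)
    moreover have "(\<lambda>k. \<Sum>j\<in>J. X j z k) \<in> tangent_space B z"
      by (rule tangent_space_sum[OF J(1)]) (rule vector_fields_tangent[OF X that])
    ultimately show ?thesis by simp
  qed
  moreover have "smooth_on (chart_image k) (local_rep (total_field X) k)" if k: "k \<in> B" for k
  proof (rule smooth_on_chart_local[OF k])
    fix z assume z: "z \<in> fst k"
    have "z \<in> (\<Union>k\<in>B. fst k)" using k z by auto
    from fin[OF this] obtain W J where W: "open_in_atlas B W" "z \<in> W" and J: "finite J" "\<forall>z'\<in>W. \<forall>j. j \<notin> J \<longrightarrow> X j z' = (\<lambda>_. 0)"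
      by (elim exE conjE)
    let ?U = "snd k ` (fst k \<inter> W)"
    have o: "open ?U" by (rule open_image_Int[OF k W(1)])
    have "smooth_on ?U (\<lambda>w. \<Sum>j\<in>J. local_rep (X j) k w)"
      by (intro smooth_on_sum o J smooth_on_subset[OF vector_fields_smooth[OF X k]]) (auto simp: chart_image_def)
    moreover have "local_rep (total_field X) k w = (\<Sum>j\<in>J. local_rep (X j) k w)" if "w \<in> ?U" for w
    proof -
      from that obtain z' where z': "z' \<in> fst k" "z' \<in> W" "w = snd k z'" by auto
      have "total_field X z' = (\<lambda>k. \<Sum>j\<in>J. X j z' k)"
        by (rule total_field_eq[OF _ J(1)]) (use J(2) z' in simp)
      then show ?thesis using z' k by (simp add: local_rep_def)
    qed
    ultimately have "smooth_on ?U (local_rep (total_field X) k)"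
      by (rule smooth_on_eqI[OF o])
    then show "\<exists>W. open_in_atlas B W \<and> z \<in> W \<and> smooth_on (snd k ` (fst k \<inter> W)) (local_rep (total_field X) k)"
      using W by blast
  qed
  ultimately show ?thesis unfolding vector_fields_def by blast
qed

text \<open>Used to evaluate a 1-form on a bracket in an arbitrary chart.\<close>

lemma bracket_tangent:
  assumes X: "X \<in> vector_fields B" and Y: "Y \<in> vector_fields B"
  shows "bracket B X Y z \<in> tangent_space B z"
proof -
  have natural: "bracket B X Y z k' = fd (transition k k') (snd k z) (bracket B X Y z k)"
    if k: "k \<in> B" "k' \<in> B" and z: "z \<in> fst k" "z \<in> fst k'" for k k'
  proof -
    let ?\<tau> = "transition k k'" and ?U = "snd k ` (fst k \<inter> fst k')" and ?w = "snd k z"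
    have U: "open ?U" "?w \<in> ?U" using open_overlap[OF k] z by auto
    have sub: "?U \<subseteq> chart_image k" by (auto simp: chart_image_def)
    note XS = smooth_on_subset[OF vector_fields_smooth[OF X k(1)] sub]
    note YS = smooth_on_subset[OF vector_fields_smooth[OF Y k(1)] sub]
    \<comment> \<open>The components of \<open>Z\<close> in \<open>k'\<close> are the derivative of
      the transition map applied to those in \<open>k\<close>. Differentiating this law expresses
      the derivative in \<open>k'\<close> by data in \<open>k\<close>, in the form that
      \<open>fd_field_commute\<close> handles.\<close>
    have main: "fd (local_rep Z k') (snd k' z) (Z' z k') = fd (\<lambda>w. fd ?\<tau> w (local_rep Z k w)) ?w (Z' z k)"
      if Z: "Z \<in> vector_fields B" and Z': "Z' \<in> vector_fields B" for Z Z'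
    proof -
      have "local_rep Z k' differentiable (at (snd k' z))"
        by (rule smooth_on_differentiable[OF vector_fields_smooth[OF Z k(2)]]) (use z in \<open>auto simp: chart_image_def\<close>)
      from has_fd[OF this] have "((\<lambda>w. local_rep Z k' (?\<tau> w)) has_derivative (\<lambda>v. fd (local_rep Z k') (snd k' z) (fd ?\<tau> ?w v))) (at ?w)"
        using has_derivative_compose[OF transition_deriv[OF k z], of "local_rep Z k'"] k z by simp
      moreover have "local_rep Z k' (?\<tau> w) = fd ?\<tau> w (local_rep Z k w)" if "w \<in> ?U" for w
      proof -
        from that obtain z' where z': "z' \<in> fst k" "z' \<in> fst k'" "w = snd k z'" by auto
        show ?thesis
          using tangent_spaceD[OF vector_fields_tangent[OF Z k(1) z'(1)] k z'(1,2)] z' k by (simp add: local_rep_def)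
      qed
      ultimately have "((\<lambda>w. fd ?\<tau> w (local_rep Z k w)) has_derivative (\<lambda>v. fd (local_rep Z k') (snd k' z) (fd ?\<tau> ?w v))) (at ?w)"
        by (rule has_derivative_transform_within_open[OF _ U])
      from fd_eqI[OF this] show ?thesis
        using tangent_spaceD[OF vector_fields_tangent[OF Z' k(1) z(1)] k z] by simp
    qed
    have e: "Z z k = local_rep Z k ?w" for Z using k z by (simp add: local_rep_def)
    have natural: "bracket B X Y z k' = fd (local_rep Y k') (snd k' z) (X z k') - fd (local_rep X k') (snd k' z) (Y z k')"
      using k z by (simp add: bracket_def)
    also have "\<dots> = fd ?\<tau> ?w (fd (local_rep Y k) ?w (X z k) - fd (local_rep X k) ?w (Y z k))"
      unfolding main[OF Y X] main[OF X Y] e by (rule fd_field_commute[OF U smooth_transition[OF k] XS YS])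
    also have "\<dots> = fd ?\<tau> ?w (bracket B X Y z k)" using k z by (simp add: bracket_def)
    finally show ?thesis .
  qed
  show ?thesis
  proof (rule tangent_spaceI)
    show "bracket B X Y z k = 0" if "\<not> (k \<in> B \<and> z \<in> fst k)" for k
      using that by (auto simp: bracket_def)
  qed (rule natural)
qed

end

section \<open>The slit tangent bundle\<close>

definition slit_chart :: "('p, 'e::euclidean_space) chart set \<Rightarrow> ('p, 'e) chart \<Rightarrow> (('p, 'e) tangent, 'e \<times> 'e) chart" where
  "slit_chart A c = ({z \<in> slit_bundle A. fst z \<in> fst c}, \<lambda>z. (snd c (fst z), snd z c))"

lemma slit_atlas_eq: "slit_atlas A = slit_chart A ` A"
  unfolding slit_atlas_def tangent_atlas_def slit_chart_def image_image
  by (rule image_cong) (auto simp: slit_bundle_def)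

lemma snd_slit_chart [simp]: "snd (slit_chart A c) z = (snd c (fst z), snd z c)"
  by (simp add: slit_chart_def)

lemma fst_slit_chart: "z \<in> fst (slit_chart A c) \<longleftrightarrow> z \<in> slit_bundle A \<and> fst z \<in> fst c"
  by (simp add: slit_chart_def)

locale manifold_atlas =
  fixes A :: "('m::{t2_space, second_countable_topology}, 'e::euclidean_space) chart set"
  assumes smooth_manifold: "smooth_manifold A"
begin

lemma covers: "\<exists>c\<in>A. p \<in> fst c"
  using smooth_manifold unfolding smooth_manifold_def by blast

lemma chart_homeo: "c \<in> A \<Longrightarrow> homeomorphism (fst c) (chart_image c) (snd c) (chart_inv c)"
  and open_chart_domain: "c \<in> A \<Longrightarrow> open (fst c)"
  using smooth_manifold unfolding smooth_manifold_def by blast+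

lemma open_chart_image_set:
  assumes "c \<in> A" "open W" shows "open (snd c ` (fst c \<inter> W))"
proof -
  have "openin (top_of_set (chart_image c)) (snd c ` (fst c \<inter> W))"
    using assms(2) by (intro homeomorphism_imp_open_map[OF chart_homeo[OF assms(1)]]) auto
  moreover have "open (chart_image c)" using smooth_manifold assms unfolding smooth_manifold_def by blast
  ultimately show ?thesis using openin_open_eq by blast
qed

sublocale base: smooth_atlas A
proof
  fix k assume k: "k \<in> A"
  show "inj_on (snd k) (fst k)"
    using homeomorphism_apply1[OF chart_homeo[OF k]] by (metis inj_onI)
  show "open_in_atlas A (fst k)"
    unfolding open_in_atlas_def using open_chart_image_set open_chart_domain[OF k] by blast
next
  fix k k' assume "k \<in> A" "k' \<in> A"
  then show "smooth_on (snd k ` (fst k \<inter> fst k')) (transition k k')"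
    using smooth_manifold unfolding smooth_manifold_def by blast
qed

lemma slit_bundle_iff: "z \<in> slit_bundle A \<longleftrightarrow> snd z \<in> tangent_space A (fst z) \<and> snd z \<noteq> (\<lambda>_. 0)"
  using covers by (auto simp: slit_bundle_def tangent_bundle_def)

text \<open>By the transformation law a tangent vector that vanishes in one chart is zero. So in
  each chart the slit bundle is the base times the nonzero vectors.\<close>

lemma slit_chart_snd_nonzero:
  assumes "c \<in> A" "z \<in> fst (slit_chart A c)" shows "snd z c \<noteq> 0"
proof
  assume "snd z c = 0"
  then have "snd z = (\<lambda>_. 0)"
    using assms base.tangent_space_eqI[OF _ base.tangent_space_zero, of "snd z" "fst z" c]
    by (simp add: fst_slit_chart slit_bundle_iff)
  then show False using assms by (simp add: fst_slit_chart slit_bundle_iff)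
qed

text \<open>An explicit inverse of the slit chart; \<open>chart_inv\<close> is an
  \<open>inv_into\<close> and offers nothing to compute with.\<close>

definition slit_point :: "('m, 'e) chart \<Rightarrow> 'e \<Rightarrow> 'e \<Rightarrow> ('m, 'e) tangent" where
  "slit_point c x y = (chart_inv c x, base.tangent_extension c (chart_inv c x) y)"

lemma slit_point:
  assumes c: "c \<in> A" and x: "x \<in> chart_image c" and y: "y \<noteq> 0"
  shows "slit_point c x y \<in> fst (slit_chart A c)" "snd (slit_chart A c) (slit_point c x y) = (x, y)"
    "fst (slit_point c x y) = chart_inv c x"
proof -
  obtain p where p: "p \<in> fst c" "x = snd c p" "chart_inv c x = p" using base.chart_image_cases[OF c x] .
  show "snd (slit_chart A c) (slit_point c x y) = (x, y)"
    using base.tangent_extension(2)[OF c p(1)] p by (simp add: slit_point_def)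
  then have "base.tangent_extension c p y \<noteq> (\<lambda>_. 0)"
    using y p by (auto simp: slit_point_def)
  then show "slit_point c x y \<in> fst (slit_chart A c)"
    using base.tangent_extension(1)[OF c p(1)] p by (simp add: slit_point_def fst_slit_chart slit_bundle_iff)
qed (simp add: slit_point_def)

lemma slit_chart_inj:
  assumes "c \<in> A" shows "inj_on (snd (slit_chart A c)) (fst (slit_chart A c))"
proof (rule inj_onI)
  fix z z' assume z: "z \<in> fst (slit_chart A c)" "z' \<in> fst (slit_chart A c)"
    and "snd (slit_chart A c) z = snd (slit_chart A c) z'"
  then have e: "snd c (fst z) = snd c (fst z')" "snd z c = snd z' c" by auto
  have "fst z = fst z'"
    using base.inj_chart[OF assms] e(1) z by (auto simp: fst_slit_chart dest: inj_onD)
  moreover have "snd z = snd z'"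
    by (rule base.tangent_space_eqI[OF _ _ assms, where z="fst z"])
      (use z e(2) \<open>fst z = fst z'\<close> in \<open>auto simp: fst_slit_chart slit_bundle_iff\<close>)
  ultimately show "z = z'" by (rule prod_eqI)
qed

lemma slit_chart_inv: "c \<in> A \<Longrightarrow> x \<in> chart_image c \<Longrightarrow> y \<noteq> 0 \<Longrightarrow> chart_inv (slit_chart A c) (x, y) = slit_point c x y"
  unfolding chart_inv_def using slit_point[of c x y] slit_chart_inj[of c] inv_into_f_f by metis

text \<open>Openness on the slit bundle reduces to this product form: chart images, overlaps and
  preimages of open sets of the base are all instances.\<close>

lemma slit_chart_image_Int:
  assumes "c \<in> A"
  shows "snd (slit_chart A c) ` (fst (slit_chart A c) \<inter> {z. fst z \<in> W}) = (snd c ` (fst c \<inter> W)) \<times> (- {0})"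
proof (intro equalityI subsetI)
  fix w assume "w \<in> snd (slit_chart A c) ` (fst (slit_chart A c) \<inter> {z. fst z \<in> W})"
  then show "w \<in> (snd c ` (fst c \<inter> W)) \<times> (- {0})"
    using slit_chart_snd_nonzero[OF assms] by (auto simp: fst_slit_chart)
next
  fix w :: "'e \<times> 'e" assume "w \<in> (snd c ` (fst c \<inter> W)) \<times> (- {0})"
  then obtain p y where w: "w = (snd c p, y)" "p \<in> fst c" "p \<in> W" "y \<noteq> 0" by auto
  then have "snd c p \<in> chart_image c" by (auto simp: chart_image_def)
  from slit_point[OF assms this w(4)] w show "w \<in> snd (slit_chart A c) ` (fst (slit_chart A c) \<inter> {z. fst z \<in> W})"
    using assms by (intro image_eqI[of _ _ "slit_point c (snd c p) y"]) auto
qed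

lemma slit_chart_image: "c \<in> A \<Longrightarrow> chart_image (slit_chart A c) = chart_image c \<times> (- {0})"
  using slit_chart_image_Int[of c UNIV] by (simp add: chart_image_def)

lemma open_in_slit_atlas:
  assumes "open W" shows "open_in_atlas (slit_atlas A) {z. fst z \<in> W}"
  unfolding open_in_atlas_def slit_atlas_eq
  using assms by (auto simp: slit_chart_image_Int simp del: snd_slit_chart intro!: open_Times open_chart_image_set)

lemma slit_overlap:
  assumes "c \<in> A"
  shows "snd (slit_chart A c) ` (fst (slit_chart A c) \<inter> fst (slit_chart A c')) = (snd c ` (fst c \<inter> fst c')) \<times> (- {0})"
proof -
  have "fst (slit_chart A c) \<inter> fst (slit_chart A c') = fst (slit_chart A c) \<inter> {z. fst z \<in> fst c'}"
    by (auto simp: fst_slit_chart)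
  then show ?thesis using slit_chart_image_Int[OF assms] by simp
qed

lemma slit_transition:
  assumes "c \<in> A" "c' \<in> A" "x \<in> snd c ` (fst c \<inter> fst c')" "y \<noteq> 0"
  shows "transition (slit_chart A c) (slit_chart A c') (x, y) = (transition c c' x, fd (transition c c') x y)"
proof -
  obtain p where p: "p \<in> fst c" "p \<in> fst c'" "x = snd c p" using assms(3) by auto
  then have "x \<in> chart_image c" by (auto simp: chart_image_def)
  then show ?thesis
    using assms p by (simp add: slit_chart_inv slit_point_def base.tangent_extension_def)
qed

lemma smooth_on_slit_transition:
  assumes c: "c \<in> A" "c' \<in> A"
  shows "smooth_on ((snd c ` (fst c \<inter> fst c')) \<times> (- {0})) (transition (slit_chart A c) (slit_chart A c'))"
proof (rule smooth_on_eqI)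
  let ?U = "snd c ` (fst c \<inter> fst c')"
  have U: "open ?U" using base.open_overlap[OF c] .
  show o: "open (?U \<times> (- {0 :: 'e}))" using U by (intro open_Times) auto
  show "smooth_on (?U \<times> (- {0})) (\<lambda>w. (transition c c' (fst w), fd (transition c c') (fst w) (snd w)))"
    by (intro smooth_on_Pair[OF o] smooth_on_compose[OF o U _ base.smooth_transition[OF c], of fst]
      smooth_on_fd_compose[OF o U base.smooth_transition[OF c]] smooth_on_bounded_linear bounded_linear_fst bounded_linear_snd) auto
  show "transition (slit_chart A c) (slit_chart A c') w = (transition c c' (fst w), fd (transition c c') (fst w) (snd w))"
    if "w \<in> ?U \<times> (- {0})" for w
    using that slit_transition[OF c, of "fst w" "snd w"] by auto
qed

sublocale slit: smooth_atlas "slit_atlas A"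
proof
  fix k assume "k \<in> slit_atlas A"
  then obtain c where c: "c \<in> A" "k = slit_chart A c" by (auto simp: slit_atlas_eq)
  show "inj_on (snd k) (fst k)" using slit_chart_inj c by simp
  show "open_in_atlas (slit_atlas A) (fst k)"
    unfolding open_in_atlas_def slit_atlas_eq c(2)
  proof (intro ballI, elim imageE)
    fix k' c' assume "k' = slit_chart A c'" "c' \<in> A"
    then show "open (snd k' ` (fst k' \<inter> fst (slit_chart A c)))"
      using slit_overlap[of c' c] base.open_overlap[OF _ c(1), of c'] by (simp add: open_Times open_Compl)
  qed
next
  fix k k' assume "k \<in> slit_atlas A" "k' \<in> slit_atlas A"
  then obtain c c' where c: "c \<in> A" "k = slit_chart A c" "c' \<in> A" "k' = slit_chart A c'" by (auto simp: slit_atlas_eq)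
  show "smooth_on (snd k ` (fst k \<inter> fst k')) (transition k k')"
    unfolding c(2,4) slit_overlap[OF c(1)] by (rule smooth_on_slit_transition[OF c(1,3)])
qed

lemma slit_chart_in [simp]: "c \<in> A \<Longrightarrow> slit_chart A c \<in> slit_atlas A"
  by (auto simp: slit_atlas_eq)

lemma slit_bundle_cover: "z \<in> slit_bundle A \<Longrightarrow> \<exists>c\<in>A. z \<in> fst (slit_chart A c)"
  using covers[of "fst z"] by (auto simp: fst_slit_chart)

text \<open>The transition map sends (x, y) to the image of x and the derivative at x applied to y,
  so its derivative is block triangular with equal diagonal blocks. The block of second derivatives
  stays unspecified: the tangent structure reads only the horizontal part of a vector and returns a
  vertical one.\<close>

lemma slit_transition_deriv:
  assumes c: "c \<in> A" "c' \<in> A" and z: "z \<in> fst (slit_chart A c)" "z \<in> fst (slit_chart A c')"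
  defines "h \<equiv> fd (transition (slit_chart A c) (slit_chart A c')) (snd (slit_chart A c) z)"
  shows "fst (h v) = fd (transition c c') (snd c (fst z)) (fst v)"
    and "h (0, b) = (0, fd (transition c c') (snd c (fst z)) b)"
proof -
  let ?\<psi> = "transition c c'" and ?\<tau> = "transition (slit_chart A c) (slit_chart A c')"
  let ?U = "(snd c ` (fst c \<inter> fst c')) \<times> (- {0 :: 'e})"
  define x y where "x = snd c (fst z)" and "y = snd z c"
  have p: "fst z \<in> fst c" "fst z \<in> fst c'" using z by (auto simp: fst_slit_chart)
  have y: "y \<noteq> 0" using slit_chart_snd_nonzero[OF c(1) z(1)] by (simp add: y_def)
  have x: "x \<in> snd c ` (fst c \<inter> fst c')" using p by (auto simp: x_def)
  have w: "snd (slit_chart A c) z = (x, y)" by (simp add: x_def y_def)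
  have oU: "open ?U" "(x, y) \<in> ?U" using base.open_overlap[OF c] x y by (auto intro!: open_Times)
  have \<tau>: "(?\<tau> has_derivative h) (at (x, y))"
    using slit.transition_deriv[OF slit_chart_in[OF c(1)] slit_chart_in[OF c(2)] z] unfolding h_def w .
  have \<psi>: "(?\<psi> has_derivative fd ?\<psi> x) (at x)"
    using base.transition_deriv[OF c p] by (simp add: x_def)
  have "((\<lambda>w. fst (?\<tau> w)) has_derivative (\<lambda>v. fst (h v))) (at (x, y))"
    using \<tau> by (rule has_derivative_fst)
  then have "((\<lambda>w. ?\<psi> (fst w)) has_derivative (\<lambda>v. fst (h v))) (at (x, y))"
  proof (rule has_derivative_transform_within_open[OF _ oU])
    show "fst (?\<tau> w) = ?\<psi> (fst w)" if "w \<in> ?U" for w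
    proof -
      have "?\<tau> (fst w, snd w) = (?\<psi> (fst w), fd ?\<psi> (fst w) (snd w))"
        by (rule slit_transition[OF c]) (use that in auto)
      then show ?thesis by (metis fst_conv prod.collapse)
    qed
  qed
  moreover have "((\<lambda>w. ?\<psi> (fst w)) has_derivative (\<lambda>v. fd ?\<psi> x (fst v))) (at (x, y))"
    by (rule has_derivative_compose[OF bounded_linear_imp_has_derivative[OF bounded_linear_fst]]) (simp only: fst_conv \<psi>)
  ultimately have "(\<lambda>v. fst (h v)) = (\<lambda>v. fd ?\<psi> x (fst v))" by (rule has_derivative_unique)
  then show "fst (h v) = fd ?\<psi> (snd c (fst z)) (fst v)" unfolding x_def by metis
  have "((\<lambda>y. (x, y)) has_derivative (\<lambda>b. (0, b))) (at y)"
    by (auto intro!: derivative_eq_intros)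
  from has_derivative_compose[OF this \<tau>]
  have "((\<lambda>y. ?\<tau> (x, y)) has_derivative (\<lambda>b. h (0, b))) (at y)" .
  moreover have "((\<lambda>y. ?\<tau> (x, y)) has_derivative (\<lambda>b. (0, fd ?\<psi> x b))) (at y)"
  proof (rule has_derivative_transform_within_open[where s="- {0}"])
    show "((\<lambda>y. (?\<psi> x, fd ?\<psi> x y)) has_derivative (\<lambda>b. (0, fd ?\<psi> x b))) (at y)"
      using has_derivative_bounded_linear[OF \<psi>] by (auto intro!: derivative_eq_intros bounded_linear_imp_has_derivative)
  qed (use y slit_transition[OF c x] in auto)
  ultimately have "(\<lambda>b. h (0, b)) = (\<lambda>b. (0, fd ?\<psi> x b))" by (rule has_derivative_unique)
  then show "h (0, b) = (0, fd ?\<psi> (snd c (fst z)) b)" unfolding x_def by metis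
qed

section \<open>The tangent structure, fibre scaling and sprays in charts\<close>

lemma slit_atlas_cases:
  assumes "k \<in> slit_atlas A" obtains c where "c \<in> A" "k = slit_chart A c"
  using assms by (auto simp: slit_atlas_eq)

lemma tangent_structure_tangent:
  assumes "Y z \<in> tangent_space (slit_atlas A) z"
  shows "tangent_structure Y z \<in> tangent_space (slit_atlas A) z"
proof (rule slit.tangent_spaceI)
  fix k k' assume k: "k \<in> slit_atlas A" "k' \<in> slit_atlas A" "z \<in> fst k" "z \<in> fst k'"
  obtain c where c: "c \<in> A" "k = slit_chart A c" using slit_atlas_cases[OF k(1)] .
  obtain c' where c': "c' \<in> A" "k' = slit_chart A c'" using slit_atlas_cases[OF k(2)] .
  note d = slit_transition_deriv[OF c(1) c'(1) k(3,4)[unfolded c c'], folded c(2) c'(2)]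
  show "tangent_structure Y z k' = fd (transition k k') (snd k z) (tangent_structure Y z k)"
    unfolding tangent_structure_def slit.tangent_spaceD[OF assms k] d ..
next
  fix k assume "\<not> (k \<in> slit_atlas A \<and> z \<in> fst k)"
  then show "tangent_structure Y z k = 0"
    using slit.tangent_space_outside[OF assms] by (simp add: tangent_structure_def zero_prod_def)
qed

lemma fibre_scale:
  assumes "z \<in> slit_bundle A" "r > 0"
  shows "fibre_scale r z \<in> slit_bundle A"
    "z \<in> fst (slit_chart A c) \<Longrightarrow> fibre_scale r z \<in> fst (slit_chart A c)"
    "snd (slit_chart A c) (fibre_scale r z) = (snd c (fst z), r *\<^sub>R snd z c)"
    "fst (fibre_scale r z) = fst z"
proof -
  have "(\<lambda>c. r *\<^sub>R snd z c) \<noteq> (\<lambda>_. 0)" using assms by (auto simp: slit_bundle_iff fun_eq_iff)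
  then show "fibre_scale r z \<in> slit_bundle A"
    using assms base.tangent_space_scale by (simp add: slit_bundle_iff fibre_scale_def)
  then show "z \<in> fst (slit_chart A c) \<Longrightarrow> fibre_scale r z \<in> fst (slit_chart A c)"
    by (simp add: fst_slit_chart fibre_scale_def)
qed (simp_all add: fibre_scale_def)

text \<open>The transition map is linear in the fibre, hence commutes with fibre scaling;
  differentiating this gives the weights 1 and \<open>r\<close>. One more factor \<open>r\<close>,
  by linearity, gives the weights \<open>r\<close> and \<open>r * r\<close> of the two components of
  a spray.\<close>

lemma slit_transition_deriv_scale:
  assumes c: "c \<in> A" "c' \<in> A" and z: "z \<in> fst (slit_chart A c)" "z \<in> fst (slit_chart A c')" and r: "r > 0"
    and h: "fd (transition (slit_chart A c) (slit_chart A c')) (snd (slit_chart A c) z) (a, b) = (a', b')"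
  shows "fd (transition (slit_chart A c) (slit_chart A c')) (snd (slit_chart A c) (fibre_scale r z)) (r *\<^sub>R a, (r * r) *\<^sub>R b)
    = (r *\<^sub>R a', (r * r) *\<^sub>R b')"
proof -
  let ?\<tau> = "transition (slit_chart A c) (slit_chart A c')"
  let ?U = "(snd c ` (fst c \<inter> fst c')) \<times> (- {0 :: 'e})"
  define m :: "'e \<times> 'e \<Rightarrow> 'e \<times> 'e" where "m w = (fst w, r *\<^sub>R snd w)" for w
  have zs: "z \<in> slit_bundle A" and p: "fst z \<in> fst c" "fst z \<in> fst c'" using z by (auto simp: fst_slit_chart)
  define w where "w = snd (slit_chart A c) z"
  have mw: "snd (slit_chart A c) (fibre_scale r z) = m w"
    using fibre_scale(3)[OF zs r] by (simp add: m_def w_def)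
  have oU: "open ?U" "w \<in> ?U" 
    using base.open_overlap[OF c] p slit_chart_snd_nonzero[OF c(1) z(1)] by (auto simp: w_def intro!: open_Times)
  have m: "(m has_derivative m) (at v)" for v
    unfolding m_def by (auto intro!: derivative_eq_intros)
  have d: "(?\<tau> has_derivative fd ?\<tau> w) (at w)"
    using slit.transition_deriv[OF slit_chart_in[OF c(1)] slit_chart_in[OF c(2)] z] unfolding w_def .
  have d': "(?\<tau> has_derivative fd ?\<tau> (m w)) (at (m w))"
    using slit.transition_deriv[OF slit_chart_in[OF c(1)] slit_chart_in[OF c(2)] fibre_scale(2)[OF zs r z(1)] fibre_scale(2)[OF zs r z(2)]]
    unfolding mw .
  have "((\<lambda>v. ?\<tau> (m v)) has_derivative (\<lambda>v. fd ?\<tau> (m w) (m v))) (at w)"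
    by (rule has_derivative_compose[OF m d'])
  moreover have "((\<lambda>v. ?\<tau> (m v)) has_derivative (\<lambda>v. m (fd ?\<tau> w v))) (at w)"
  proof (rule has_derivative_transform_within_open[OF has_derivative_compose[OF d m] oU])
    fix v assume v: "v \<in> ?U"
    then have lin: "linear (fd (transition c c') (fst v))"
      using base.linear_transition_deriv[OF c] by auto
    show "m (?\<tau> v) = ?\<tau> (m v)"
      using v r slit_transition[OF c, of "fst v" "snd v"] slit_transition[OF c, of "fst v" "r *\<^sub>R snd v"]
      by (auto simp: m_def linear_scale[OF lin])
  qed
  ultimately have "(\<lambda>v. fd ?\<tau> (m w) (m v)) = (\<lambda>v. m (fd ?\<tau> w v))" by (rule has_derivative_unique)
  then have e: "fd ?\<tau> (m w) (m (a, b)) = m (a', b')" using h unfolding w_def[symmetric] by metis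
  have "(r *\<^sub>R a, (r * r) *\<^sub>R b) = r *\<^sub>R m (a, b)" by (simp add: m_def)
  then show ?thesis
    unfolding mw using linear_scale[OF has_derivative_linear[OF d'], of r "m (a, b)"] e by (simp add: m_def)
qed

text \<open>Replaces the bracket condition by pointwise scaling, which is easy to check for sums of
  cut off fields: differentiating the scaling law along a ray at \<open>t = 1\<close> gives back
  [C, S] = S.\<close>

lemma sprayI:
  assumes S: "S \<in> vector_fields (slit_atlas A)"
    and fst_S: "\<And>c z. c \<in> A \<Longrightarrow> z \<in> fst (slit_chart A c) \<Longrightarrow> fst (S z (slit_chart A c)) = snd z c"
    and hom: "\<And>c z r. c \<in> A \<Longrightarrow> z \<in> fst (slit_chart A c) \<Longrightarrow> r > 0 \<Longrightarrow>
      snd (S (fibre_scale r z) (slit_chart A c)) = (r * r) *\<^sub>R snd (S z (slit_chart A c))"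
  shows "spray A S"
  unfolding spray_def
proof (intro conjI S ballI)
  fix z assume z: "z \<in> slit_bundle A"
  then obtain c0 where "c0 \<in> A" "z \<in> fst (slit_chart A c0)" using slit_bundle_cover by blast
  then have T: "S z \<in> tangent_space (slit_atlas A) z" using slit.vector_fields_tangent[OF S slit_chart_in] by blast
  show "tangent_structure S z = liouville A z"
  proof
    fix k show "tangent_structure S z k = liouville A z k"
    proof (cases "k \<in> slit_atlas A \<and> z \<in> fst k")
      case True
      then obtain c where c: "c \<in> A" "k = slit_chart A c" using slit_atlas_cases by blast
      then show ?thesis using True fst_S[of c z] by (simp add: tangent_structure_def liouville_def)
    next
      case False
      then show ?thesis
        using slit.tangent_space_outside[OF T False] by (auto simp: tangent_structure_def liouville_def zero_prod_def)
    qed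
  qed
  show "bracket (slit_atlas A) (liouville A) S z = S z"
  proof
    fix k show "bracket (slit_atlas A) (liouville A) S z k = S z k"
    proof (cases "k \<in> slit_atlas A \<and> z \<in> fst k")
      case False
      then show ?thesis
        using slit.tangent_space_outside[OF T False] by (auto simp: bracket_def)
    next
      case True
      then obtain c where c: "c \<in> A" "k = slit_chart A c" using slit_atlas_cases by blast
      have zc: "z \<in> fst (slit_chart A c)" using True c by simp
      define x y where "x = snd c (fst z)" and "y = snd z c"
      have w: "snd k z = (x, y)" by (simp add: c x_def y_def)
      have kz: "k \<in> slit_atlas A" "z \<in> fst k" using True by auto
      have wi: "(x, y) \<in> chart_image k" using kz(2) unfolding w[symmetric] chart_image_def by (rule imageI)
      have "(local_rep (liouville A) k has_derivative (\<lambda>v. (0, snd v))) (at (x, y))"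
      proof (rule has_derivative_transform_within_open[OF _ slit.open_chart_image[OF kz(1)] wi])
        show "((\<lambda>v. (0 :: 'e, snd v :: 'e)) has_derivative (\<lambda>v. (0, snd v))) (at (x, y))"
          by (auto intro!: derivative_eq_intros)
        show "(0, snd v) = local_rep (liouville A) k v" if v: "v \<in> chart_image k" for v
        proof -
          obtain z' where z': "z' \<in> fst k" "v = snd k z'" "chart_inv k v = z'"
            using slit.chart_image_cases[OF kz(1) v] .
          then have "local_rep (liouville A) k v = (0, snd (snd k z'))"
            using kz(1) by (simp only: local_rep_def liouville_def z') simp
          then show ?thesis using z'(2) by simp
        qed
      qed
      from fd_eqI[OF this] have 1: "fd (local_rep (liouville A) k) (snd k z) (S z k) = (0, snd (S z k))"
        by (simp add: w)
      define W where "W = snd (S z k)"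
      have Sd: "(local_rep S k has_derivative fd (local_rep S k) (x, y)) (at (x, y))"
        by (rule smooth_on_has_fd[OF slit.vector_fields_smooth[OF S kz(1)] wi])
      \<comment> \<open>At \<open>t = 1\<close> this curve has velocity \<open>(0, y)\<close>, the
        value of the Liouville field.\<close>
      have "((\<lambda>t. local_rep S k (x, t *\<^sub>R y)) has_derivative (\<lambda>t. fd (local_rep S k) (x, y) (0, t *\<^sub>R y))) (at (1::real))"
        by (rule has_derivative_compose[where f="\<lambda>t. (x, t *\<^sub>R y)"]) (use Sd in \<open>auto intro!: derivative_eq_intros\<close>)
      moreover have "((\<lambda>t. local_rep S k (x, t *\<^sub>R y)) has_derivative (\<lambda>t. (t *\<^sub>R y, (2 * t) *\<^sub>R W))) (at (1::real))"
      proof (rule has_derivative_transform_within_open[where s="{0<..}"])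
        show "((\<lambda>t. (t *\<^sub>R y, (t * t) *\<^sub>R W)) has_derivative (\<lambda>t. (t *\<^sub>R y, (2 * t) *\<^sub>R W))) (at (1::real))"
          by (auto intro!: derivative_eq_intros)
        show "(t *\<^sub>R y, (t * t) *\<^sub>R W) = local_rep S k (x, t *\<^sub>R y)" if "t \<in> {0<..}" for t :: real
        proof -
          have t: "t > 0" using that by simp
          have "snd k (fibre_scale t z) = (x, t *\<^sub>R y)" using fibre_scale(3)[OF z t] by (simp add: c x_def y_def)
          then have "chart_inv k (x, t *\<^sub>R y) = fibre_scale t z"
            using slit.chart_inv_chart[OF kz(1), of "fibre_scale t z"] fibre_scale(2)[OF z t zc] c by simp
          moreover have "S (fibre_scale t z) k = (t *\<^sub>R y, (t * t) *\<^sub>R W)"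
            using hom[OF c(1) zc t] fst_S[OF c(1) fibre_scale(2)[OF z t zc]] fibre_scale(3)[OF z t, of c]
            by (auto simp: c(2) W_def y_def prod_eq_iff)
          ultimately show ?thesis by (simp add: local_rep_def)
        qed
      qed auto
      ultimately have "(\<lambda>t. fd (local_rep S k) (x, y) (0, t *\<^sub>R y)) = (\<lambda>t. (t *\<^sub>R y, (2 * t) *\<^sub>R W))"
        by (rule has_derivative_unique)
      from fun_cong[OF this, of 1] have 2: "fd (local_rep S k) (snd k z) (0, y) = (y, 2 *\<^sub>R W)" by (simp add: w)
      have C: "liouville A z k = (0, y)" using kz w by (simp add: liouville_def)
      have "bracket (slit_atlas A) (liouville A) S z k = (y, 2 *\<^sub>R W) - (0, W)"
        using kz 1 2 by (simp add: bracket_def C W_def)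
      also have "\<dots> = S z k" using fst_S[OF c(1) zc] by (simp add: W_def c(2) y_def prod_eq_iff scaleR_2)
      finally show ?thesis .
    qed
  qed
qed

end

section \<open>Extending a local spray\<close>

context manifold_atlas
begin

text \<open>\<open>K\<close> is closed in the whole manifold and not merely in the chart domain;
  this is what allows extension by zero.\<close>

definition cutoff :: "('m, 'e) chart \<Rightarrow> ('m \<Rightarrow> real) \<Rightarrow> bool" where
  "cutoff c \<psi> \<longleftrightarrow> smooth_fun A \<psi> \<and> (\<exists>K. closed K \<and> K \<subseteq> fst c \<and> (\<forall>q. q \<notin> K \<longrightarrow> \<psi> q = 0))"

lemma cutoff_mult:
  assumes "cutoff c \<psi>" "smooth_fun A \<phi>" shows "cutoff c (\<lambda>q. \<psi> q * \<phi> q)"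
proof -
  obtain K where "closed K" "K \<subseteq> fst c" "\<forall>q. q \<notin> K \<longrightarrow> \<psi> q = 0" and s: "smooth_fun A \<psi>"
    using assms(1) unfolding cutoff_def by blast
  then show ?thesis
    unfolding cutoff_def by (intro conjI exI[of _ K] base.smooth_fun_mult[OF s assms(2)]) auto
qed

lemma open_in_base_atlas: "open W \<Longrightarrow> open_in_atlas A W"
  unfolding open_in_atlas_def using open_chart_image_set by blast

lemma cutoff_exists:
  assumes c: "c \<in> A" and p: "p \<in> fst c"
  shows "\<exists>\<psi> N. cutoff c \<psi> \<and> open N \<and> p \<in> N \<and> N \<subseteq> fst c \<and> (\<forall>q\<in>N. \<psi> q = 1)"
proof -
  define x where "x = snd c p"
  have "open (chart_image c)" "x \<in> chart_image c"
    using base.open_chart_image[OF c] p by (auto simp: x_def chart_image_def)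
  then obtain e where e: "e > 0" "cball x e \<subseteq> chart_image c" using open_contains_cball by blast
  \<comment> \<open>\<open>smooth_bump\<close> lives on the ball of radius \<open>2 * r\<close>,
    whose closure has to stay inside the chart image.\<close>
  define r where "r = e / 2"
  have r: "r > 0" "cball x (2 * r) \<subseteq> chart_image c" using e by (auto simp: r_def)
  obtain \<beta> :: "'e \<Rightarrow> real" where \<beta>: "smooth_on UNIV \<beta>" "\<And>y. y \<in> cball x r \<Longrightarrow> \<beta> y = 1" "\<And>y. y \<notin> ball x (2 * r) \<Longrightarrow> \<beta> y = 0"
    using smooth_bump[OF r(1), of x] by metis
  define \<psi> where "\<psi> q = (if q \<in> fst c then \<beta> (snd c q) else 0)" for q
  define K where "K = chart_inv c ` cball x (2 * r)"
  define N where "N = fst c \<inter> snd c -` ball x r"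
  have "continuous_on (chart_image c) (chart_inv c)" using homeomorphism_cont2[OF chart_homeo[OF c]] .
  then have "compact K" unfolding K_def
    using r(2) by (intro compact_continuous_image) (auto intro: continuous_on_subset)
  \<comment> \<open>The Hausdorff property of \<open>'m\<close> enters here: a relatively closed
    subset of the chart domain need not be closed in the manifold, a compact one is.\<close>
  then have K: "closed K" by (rule compact_imp_closed)
  have Kc: "K \<subseteq> fst c" using r(2) base.chart_image_cases[OF c] unfolding K_def by (metis image_subsetI subset_iff)
  have K0: "\<psi> q = 0" if "q \<notin> K" for q
  proof (cases "q \<in> fst c")
    case True
    have "snd c q \<notin> ball x (2 * r)"
    proof
      assume "snd c q \<in> ball x (2 * r)"
      then have "chart_inv c (snd c q) \<in> K" unfolding K_def by (intro imageI) auto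
      then show False using that base.chart_inv_chart[OF c True] by simp
    qed
    then show ?thesis using \<beta>(3) by (simp add: \<psi>_def)
  qed (simp add: \<psi>_def)
  have "open N" unfolding N_def
    using homeomorphism_cont1[OF chart_homeo[OF c]] open_chart_domain[OF c] by (intro continuous_open_preimage) auto
  moreover have "p \<in> N" using p r by (simp add: N_def x_def)
  moreover have "\<psi> q = 1" if "q \<in> N" for q using that \<beta>(2) by (simp add: N_def \<psi>_def)
  moreover have "smooth_fun A \<psi>"
    unfolding smooth_fun_def
  proof
    fix c' assume c': "c' \<in> A"
    show "smooth_on (chart_image c') (\<psi> \<circ> chart_inv c')"
    proof (rule base.smooth_on_chart_local[OF c'])
      fix q assume q: "q \<in> fst c'"
      show "\<exists>W. open_in_atlas A W \<and> q \<in> W \<and> smooth_on (snd c' ` (fst c' \<inter> W)) (\<psi> \<circ> chart_inv c')"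
      proof (cases "q \<in> fst c")
        case True
        have "smooth_on (snd c' ` (fst c' \<inter> fst c)) (\<lambda>w. \<beta> (transition c' c w))"
          by (rule smooth_on_compose[OF base.open_overlap[OF c' c] open_UNIV base.smooth_transition[OF c' c] \<beta>(1)]) simp
        then have "smooth_on (snd c' ` (fst c' \<inter> fst c)) (\<psi> \<circ> chart_inv c')"
          by (rule smooth_on_eqI[OF base.open_overlap[OF c' c]]) (use c' in \<open>auto simp: \<psi>_def\<close>)
        then show ?thesis using True base.open_domain[OF c] by blast
      next
        case False
        have o: "open_in_atlas A (- K)" using K by (intro open_in_base_atlas) auto
        have "smooth_on (snd c' ` (fst c' \<inter> - K)) (\<psi> \<circ> chart_inv c')"
          by (rule smooth_on_eqI[OF base.open_image_Int[OF c' o] smooth_on_const]) (use c' K0 in auto)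
        then show ?thesis using False Kc o by blast
      qed
    qed
  qed
  ultimately show ?thesis using K Kc K0 unfolding cutoff_def N_def by blast
qed

section \<open>Cutoff fields on the slit bundle\<close>

abbreviation slit_cutoff_field where
  "slit_cutoff_field c \<psi> V \<equiv> slit.cutoff_field (slit_chart A c) (\<lambda>z. \<psi> (fst z)) V"

lemma smooth_fun_slit:
  assumes "smooth_fun A \<psi>" shows "smooth_fun (slit_atlas A) (\<lambda>z. \<psi> (fst z))"
  unfolding smooth_fun_def
proof
  fix k assume "k \<in> slit_atlas A"
  then obtain c where c: "c \<in> A" "k = slit_chart A c" by (rule slit_atlas_cases)
  have o: "open (chart_image c \<times> (- {0 :: 'e}))" using base.open_chart_image[OF c(1)] by (intro open_Times) auto
  have "smooth_on (chart_image c \<times> (- {0 :: 'e})) (\<lambda>w. (\<psi> \<circ> chart_inv c) (fst w))"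
    by (rule smooth_on_compose[OF o base.open_chart_image[OF c(1)] smooth_on_bounded_linear[OF bounded_linear_fst]
      base.smooth_funD[OF assms c(1)]]) auto
  then show "smooth_on (chart_image k) ((\<lambda>z. \<psi> (fst z)) \<circ> chart_inv k)"
    unfolding c(2) slit_chart_image[OF c(1)]
  proof (rule smooth_on_eqI[OF o])
    fix w assume w: "w \<in> chart_image c \<times> (- {0 :: 'e})"
    have w': "fst w \<in> chart_image c" "snd w \<noteq> 0" using w by (simp_all add: mem_Times_iff)
    show "((\<lambda>z. \<psi> (fst z)) \<circ> chart_inv (slit_chart A c)) w = (\<psi> \<circ> chart_inv c) (fst w)"
      using slit_chart_inv[OF c(1) w'] slit_point(3)[OF c(1) w'] by simp
  qed
qed

lemma slit_cutoff_field:
  assumes c: "c \<in> A" and \<psi>: "cutoff c \<psi>" and V: "smooth_on (chart_image c \<times> (- {0})) V"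
  shows "slit_cutoff_field c \<psi> V \<in> vector_fields (slit_atlas A)"
proof -
  obtain K where K: "closed K" "K \<subseteq> fst c" "\<And>q. q \<notin> K \<Longrightarrow> \<psi> q = 0" and s: "smooth_fun A \<psi>"
    using \<psi> unfolding cutoff_def by blast
  have o: "open_in_atlas (slit_atlas A) {z. fst z \<in> - K}" using K by (intro open_in_slit_atlas) auto
  show ?thesis
  proof (rule slit.cutoff_field[where K="{z \<in> slit_bundle A. fst z \<in> K}"])
    show "slit_chart A c \<in> slit_atlas A" using c by simp
    show "smooth_on (chart_image (slit_chart A c)) V" using V by (simp add: slit_chart_image[OF c])
    show "smooth_fun (slit_atlas A) (\<lambda>z. \<psi> (fst z))" by (rule smooth_fun_slit[OF s])
    show "{z \<in> slit_bundle A. fst z \<in> K} \<subseteq> fst (slit_chart A c)" using K by (auto simp: fst_slit_chart)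
    show "open_in_atlas (slit_atlas A) (- {z \<in> slit_bundle A. fst z \<in> K})"
      unfolding open_in_atlas_def
    proof
      fix k assume k: "k \<in> slit_atlas A"
      have "fst k \<inter> - {z \<in> slit_bundle A. fst z \<in> K} = fst k \<inter> {z. fst z \<in> - K}"
        using k by (auto simp: slit_atlas_eq slit_chart_def)
      then show "open (snd k ` (fst k \<inter> - {z \<in> slit_bundle A. fst z \<in> K}))"
        using slit.open_image_Int[OF k o] by metis
    qed
    show "\<psi> (fst z) = 0" if "k \<in> slit_atlas A" "z \<in> fst k" "z \<notin> {z \<in> slit_bundle A. fst z \<in> K}" for k z
      using that K(3) by (auto simp: slit_atlas_eq slit_chart_def)
  qed
qed

text \<open>The spray conditions are given for \<open>V\<close> in the chart \<open>c\<close> and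
  wanted in \<open>c'\<close>. Block triangularity of the transition derivative yields the first
  component, \<open>slit_transition_deriv_scale\<close> the scaling of the second; the factor
  \<open>\<psi>\<close> depends on the base point only and is not affected by fibre scaling.\<close>

lemma slit_cutoff_field_spray:
  assumes c: "c \<in> A" and \<psi>: "cutoff c \<psi>" and c': "c' \<in> A" and z: "z \<in> fst (slit_chart A c')"
    and V1: "\<And>x y. y \<noteq> 0 \<Longrightarrow> fst (V (x, y)) = y"
    and V2: "\<And>x y r. y \<noteq> 0 \<Longrightarrow> r > 0 \<Longrightarrow> snd (V (x, r *\<^sub>R y)) = (r * r) *\<^sub>R snd (V (x, y))"
  shows "fst (slit_cutoff_field c \<psi> V z (slit_chart A c')) = \<psi> (fst z) *\<^sub>R snd z c'"
    and "r > 0 \<Longrightarrow> snd (slit_cutoff_field c \<psi> V (fibre_scale r z) (slit_chart A c'))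
      = (r * r) *\<^sub>R snd (slit_cutoff_field c \<psi> V z (slit_chart A c'))"
proof -
  have zs: "z \<in> slit_bundle A" using z by (simp add: fst_slit_chart)
  have Q: "fst (slit_cutoff_field c \<psi> V z (slit_chart A c')) = \<psi> (fst z) *\<^sub>R snd z c' \<and>
    (r > 0 \<longrightarrow> snd (slit_cutoff_field c \<psi> V (fibre_scale r z) (slit_chart A c'))
      = (r * r) *\<^sub>R snd (slit_cutoff_field c \<psi> V z (slit_chart A c')))"
  proof (cases "fst z \<in> fst c")
    case False
    then have "\<psi> (fst z) = 0" using \<psi> unfolding cutoff_def by blast
    then show ?thesis by (simp add: slit.cutoff_field_def fibre_scale_def)
  next
    case True
    then have zc: "z \<in> fst (slit_chart A c)" using zs by (simp add: fst_slit_chart)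
    let ?h = "fd (transition (slit_chart A c) (slit_chart A c'))"
    define x y where "x = snd c (fst z)" and "y = snd z c"
    have y: "y \<noteq> 0" using slit_chart_snd_nonzero[OF c zc] by (simp add: y_def)
    have w: "snd (slit_chart A c) z = (x, y)" by (simp add: x_def y_def)
    have val: "slit.tangent_extension (slit_chart A c) z (V (snd (slit_chart A c) z)) (slit_chart A c') = ?h (x, y) (V (x, y))"
      unfolding slit.tangent_extension_def w using c' z by simp
    have "snd z c' = fd (transition c c') x y"
      using base.tangent_spaceD[of "snd z" "fst z" c c'] zs z c c' True
      by (simp add: slit_bundle_iff x_def y_def fst_slit_chart)
    then have "fst (?h (x, y) (V (x, y))) = snd z c'"
      using slit_transition_deriv(1)[OF c c' zc z, of "V (x, y)"] V1[OF y, of x] w by (simp add: x_def)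
    moreover have "snd (?h (x, r *\<^sub>R y) (V (x, r *\<^sub>R y))) = (r * r) *\<^sub>R snd (?h (x, y) (V (x, y)))"
      "slit.tangent_extension (slit_chart A c) (fibre_scale r z) (V (snd (slit_chart A c) (fibre_scale r z))) (slit_chart A c')
        = ?h (x, r *\<^sub>R y) (V (x, r *\<^sub>R y))" if r: "r > 0"
    proof -
      have w': "snd (slit_chart A c) (fibre_scale r z) = (x, r *\<^sub>R y)"
        using fibre_scale(3)[OF zs r] by (simp add: x_def y_def)
      have "V (x, r *\<^sub>R y) = (r *\<^sub>R fst (V (x, y)), (r * r) *\<^sub>R snd (V (x, y)))"
        using V1[of "r *\<^sub>R y" x] V1[OF y, of x] V2[OF y r, of x] r y by (simp add: prod_eq_iff)
      then show "snd (?h (x, r *\<^sub>R y) (V (x, r *\<^sub>R y))) = (r * r) *\<^sub>R snd (?h (x, y) (V (x, y)))"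
        using slit_transition_deriv_scale[OF c c' zc z r, of "fst (V (x, y))" "snd (V (x, y))"
          "fst (?h (x, y) (V (x, y)))" "snd (?h (x, y) (V (x, y)))"] unfolding w w' by simp
      show "slit.tangent_extension (slit_chart A c) (fibre_scale r z) (V (snd (slit_chart A c) (fibre_scale r z))) (slit_chart A c')
        = ?h (x, r *\<^sub>R y) (V (x, r *\<^sub>R y))"
        unfolding slit.tangent_extension_def w' using c' fibre_scale(2)[OF zs r z] by simp
    qed
    ultimately show ?thesis
      unfolding slit.cutoff_field_def using val fibre_scale(4)[OF zs, of r] by auto
  qed
  then show "fst (slit_cutoff_field c \<psi> V z (slit_chart A c')) = \<psi> (fst z) *\<^sub>R snd z c'"
    and "r > 0 \<Longrightarrow> snd (slit_cutoff_field c \<psi> V (fibre_scale r z) (slit_chart A c'))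
      = (r * r) *\<^sub>R snd (slit_cutoff_field c \<psi> V z (slit_chart A c'))" by auto
qed

text \<open>The telescoping products \<open>\<psi>\<^sub>j \<Prod>\<^sub>i\<^sub><\<^sub>j (1 - \<psi>\<^sub>i)\<close> vanish for \<open>j > i\<close> wherever \<open>\<psi>\<^sub>i = 1\<close>,
  so a countable cover suffices and no locally finite refinement is needed.\<close>

lemma partition_of_unity:
  assumes c0: "c0 \<in> A" and p0: "p0 \<in> fst c0"
  shows "\<exists>C \<phi> N. (\<forall>j::nat. C j \<in> A \<and> cutoff (C j) (\<phi> j) \<and> open (N j)) \<and> (\<Union>j. N j) = UNIV \<and>
    (\<forall>i. \<forall>p\<in>N i. (\<forall>j>i. \<phi> j p = 0) \<and> (\<Sum>j\<le>i. \<phi> j p) = 1) \<and> C 0 = c0 \<and> p0 \<in> N 0 \<and> N 0 \<subseteq> fst c0"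
proof -
  have "\<exists>c \<psi> N. c \<in> A \<and> (p = p0 \<longrightarrow> c = c0) \<and> cutoff c \<psi> \<and> open N \<and> p \<in> N \<and> N \<subseteq> fst c \<and> (\<forall>q\<in>N. \<psi> q = 1)" for p
  proof -
    obtain c where "c \<in> A" "p \<in> fst c" "p = p0 \<longrightarrow> c = c0" using c0 p0 covers[of p] by metis
    then show ?thesis using cutoff_exists[of c p] by blast
  qed
  then obtain C \<psi> N where C: "\<And>p. C p \<in> A \<and> (p = p0 \<longrightarrow> C p = c0) \<and> cutoff (C p) (\<psi> p) \<and> open (N p) \<and> p \<in> N p \<and> N p \<subseteq> fst (C p)
      \<and> (\<forall>q\<in>N p. \<psi> p q = 1)" by metis
  have N: "open (N p)" "p \<in> N p" "\<And>q. q \<in> N p \<Longrightarrow> \<psi> p q = 1" for p using C by blast+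
  \<comment> \<open>Second countability of \<open>'m\<close> enters here: countably many of the
    neighbourhoods still cover.\<close>
  obtain F where F: "F \<subseteq> range N" "countable F" "\<Union>F = \<Union>(range N)"
    using Lindelof[of "range N"] N(1) by blast
  then obtain D where D: "countable D" "F = N ` D" using countable_subset_image[of F N UNIV] by blast
  have cov: "(\<Union>p\<in>D. N p) = UNIV" using F(3) D(2) N(2) by blast
  then have "D \<noteq> {}" by auto
  \<comment> \<open>The sequence starts with \<open>p0\<close>: the empty product makes the first
    function \<open>\<psi> p0\<close> itself, which is 1 on its neighbourhood, so there the
    prescribed chart alone contributes. Repetitions in the enumeration of a finite \<open>D\<close>
    do no harm to the telescoping.\<close>
  define q where "q j = (case j of 0 \<Rightarrow> p0 | Suc n \<Rightarrow> from_nat_into D n)" for j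
  have "D = range (from_nat_into D)" using range_from_nat_into[OF \<open>D \<noteq> {}\<close> D(1)] by simp
  then have Dq: "D \<subseteq> range (\<lambda>n. q (Suc n))" by (auto simp: q_def)
  define \<phi> where "\<phi> j p = \<psi> (q j) p * (\<Prod>i<j. 1 - \<psi> (q i) p)" for j p
  have sum: "(\<Sum>j<n. \<phi> j p) = 1 - (\<Prod>j<n. 1 - \<psi> (q j) p)" for n p
    by (induction n) (simp_all add: \<phi>_def algebra_simps)
  have s: "smooth_fun A (\<psi> p)" for p using C unfolding cutoff_def by blast
  show ?thesis
  proof (intro exI[of _ "\<lambda>j. C (q j)"] exI[of _ \<phi>] exI[of _ "\<lambda>j. N (q j)"] conjI allI ballI impI)
    show "C (q j) \<in> A" "open (N (q j))" for j using C by blast+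
    show "cutoff (C (q j)) (\<phi> j)" for j
      unfolding \<phi>_def using C by (intro cutoff_mult base.smooth_fun_prod base.smooth_fun_diff base.smooth_fun_const s) auto
    show "(\<Union>j. N (q j)) = UNIV"
    proof (intro equalityI subset_UNIV subsetI)
      fix x :: 'm
      obtain p where p: "p \<in> D" "x \<in> N p" using cov by blast
      obtain n where "p = q (Suc n)" using p(1) Dq by blast
      then show "x \<in> (\<Union>j. N (q j))" using p(2) by (intro UN_I[of "Suc n"]) auto
    qed
    show "\<phi> j p = 0" if "p \<in> N (q i)" "i < j" for i j p
      unfolding \<phi>_def using N(3)[OF that(1)] that(2) by force
    show "(\<Sum>j\<le>i. \<phi> j p) = 1" if "p \<in> N (q i)" for i p
    proof -
      have "(\<Sum>j<Suc i. \<phi> j p) = 1 - (\<Prod>j<Suc i. 1 - \<psi> (q j) p)" by (rule sum)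
      then show ?thesis using N(3)[OF that] by (auto simp: lessThan_Suc_atMost)
    qed
    show "C (q 0) = c0" "p0 \<in> N (q 0)" "N (q 0) \<subseteq> fst c0" using C[of p0] by (auto simp: q_def)
  qed
qed

text \<open>Sprays form an affine space: weights of sum 1 preserve the first component
  \<open>y\<close> and the 2-homogeneity of the second. Near \<open>p0\<close> the first weight is 1
  and the others vanish, so the prescribed force \<open>W\<close> survives unchanged there.\<close>

lemma spray_extension:
  assumes c0: "c0 \<in> A" and p0: "p0 \<in> fst c0"
    and W: "smooth_on (chart_image c0 \<times> (- {0})) W"
    and W2: "\<And>x y r. y \<noteq> 0 \<Longrightarrow> r > 0 \<Longrightarrow> W (x, r *\<^sub>R y) = (r * r) *\<^sub>R W (x, y)"
  shows "\<exists>S N. spray A S \<and> open N \<and> p0 \<in> N \<and> N \<subseteq> fst c0 \<and>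
    (\<forall>z\<in>fst (slit_chart A c0). fst z \<in> N \<longrightarrow> S z (slit_chart A c0) = (snd z c0, W (snd (slit_chart A c0) z)))"
proof -
  obtain C :: "nat \<Rightarrow> _" and \<phi> N where C: "\<And>j. C j \<in> A" "\<And>j. cutoff (C j) (\<phi> j)" and N: "\<And>j. open (N j)" "(\<Union>j. N j) = UNIV"
    and \<phi>: "\<And>i j p. p \<in> N i \<Longrightarrow> i < j \<Longrightarrow> \<phi> j p = 0" "\<And>i p. p \<in> N i \<Longrightarrow> (\<Sum>j\<le>i. \<phi> j p) = 1"
    and 0: "C 0 = c0" "p0 \<in> N 0" "N 0 \<subseteq> fst c0"
    using partition_of_unity[OF c0 p0] by metis
  \<comment> \<open>For every other index the force is 0, which is the flat spray of the respective
    chart.\<close>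
  define V where "V j w = (snd w, if j = (0::nat) then W w else 0)" for j w
  define X where "X j = slit_cutoff_field (C j) (\<phi> j) (V j)" for j
  have o: "open (chart_image (C j) \<times> (- {0 :: 'e}))" for j
    using base.open_chart_image[OF C(1)[of j]] by (intro open_Times) auto
  have V: "smooth_on (chart_image (C j) \<times> (- {0})) (V j)" for j
  proof -
    have "smooth_on (chart_image (C j) \<times> (- {0})) (\<lambda>w. if j = 0 then W w else 0)"
      using W 0(1) by (cases "j = 0") auto
    then show ?thesis
      unfolding V_def by (rule smooth_on_Pair[OF o smooth_on_bounded_linear[OF bounded_linear_snd]])
  qed
  have V1: "fst (V j (x, y)) = y" for j x y by (simp add: V_def)
  have V2: "snd (V j (x, r *\<^sub>R y)) = (r * r) *\<^sub>R snd (V j (x, y))" if "y \<noteq> 0" "r > 0" for j x y r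
    using that W2 by (simp add: V_def)
  have X: "X j \<in> vector_fields (slit_atlas A)" for j
    unfolding X_def by (rule slit_cutoff_field[OF C V])
  have X0: "X j z = (\<lambda>_. 0)" if "fst z \<in> N i" "j \<notin> {..i}" for i j z
    using \<phi>(1)[OF that(1), of j] that(2) by (simp add: X_def slit.cutoff_field_def not_le)
  define S where "S = slit.total_field X"
  have S_eq: "S z = (\<lambda>k. \<Sum>j\<le>i. X j z k)" if "fst z \<in> N i" for z i
    unfolding S_def by (rule slit.total_field_eq) (use X0[OF that] in auto)
  have S: "S \<in> vector_fields (slit_atlas A)"
    unfolding S_def
  proof (rule slit.total_field[OF X])
    fix z :: "('m, 'e) tangent"
    obtain i where "fst z \<in> N i" using N(2) by blast
    then show "\<exists>W J. open_in_atlas (slit_atlas A) W \<and> z \<in> W \<and> finite J \<and> (\<forall>z'\<in>W. \<forall>j. j \<notin> J \<longrightarrow> X j z' = (\<lambda>_. 0))"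
      using open_in_slit_atlas[OF N(1)[of i]] X0
      by (intro exI[of _ "{z. fst z \<in> N i}"] exI[of _ "{..i}"]) auto
  qed
  have "spray A S"
  proof (rule sprayI[OF S])
    fix c z assume c: "c \<in> A" and z: "z \<in> fst (slit_chart A c)"
    obtain i where i: "fst z \<in> N i" using N(2) by blast
    have "fst (S z (slit_chart A c)) = (\<Sum>j\<le>i. \<phi> j (fst z) *\<^sub>R snd z c)"
      unfolding S_eq[OF i] fst_sum X_def
      by (intro sum.cong refl slit_cutoff_field_spray(1)[OF C c z]) (use V1 V2 in auto)
    also have "\<dots> = snd z c" using \<phi>(2)[OF i] by (simp flip: scaleR_sum_left)
    finally show "fst (S z (slit_chart A c)) = snd z c" .
    fix r :: real assume r: "r > 0"
    have i': "fst (fibre_scale r z) \<in> N i" using i by (simp add: fibre_scale_def)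
    have "snd (S (fibre_scale r z) (slit_chart A c)) = (\<Sum>j\<le>i. (r * r) *\<^sub>R snd (X j z (slit_chart A c)))"
      unfolding S_eq[OF i'] snd_sum X_def
      by (intro sum.cong refl slit_cutoff_field_spray(2)[OF C c z _ _ r]) (use V1 V2 in auto)
    then show "snd (S (fibre_scale r z) (slit_chart A c)) = (r * r) *\<^sub>R snd (S z (slit_chart A c))"
      unfolding S_eq[OF i] by (simp add: snd_sum scaleR_sum_right)
  qed
  moreover have "S z (slit_chart A c0) = (snd z c0, W (snd (slit_chart A c0) z))"
    if z: "z \<in> fst (slit_chart A c0)" and "fst z \<in> N 0" for z
    using S_eq[OF that(2)] \<phi>(2)[OF that(2)] slit.cutoff_field_chart[OF slit_chart_in[OF c0] z, of "\<lambda>z. \<phi> 0 (fst z)" "V 0"]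
    by (simp add: X_def 0(1) V_def)
  ultimately show ?thesis using N(1)[of 0] 0 by blast
qed

end

section \<open>A spray that is not projectively variational\<close>

text \<open>The equation \<open>S(g) = k\<close> differentiated in the constant direction \<open>v\<close>, with the derivatives of
  \<open>g\<close> interchanged.\<close>

lemma fd_along_equation:
  fixes g :: "'a::euclidean_space \<Rightarrow> 'b::euclidean_space"
  assumes \<Omega>: "open \<Omega>" "w \<in> \<Omega>" and g: "smooth_on \<Omega> g" and S: "smooth_on \<Omega> S"
    and eq: "\<And>w. w \<in> \<Omega> \<Longrightarrow> fd g w (S w) = k w"
  shows "fd (\<lambda>y. fd g y v) w (S w) + fd g w (fd S w v) = fd k w v"
  using fd_fd_field[OF \<Omega> g S, of v] fd_fd_commute[OF \<Omega> g, of "S w" v]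
    fd_cong[OF \<Omega>, of "\<lambda>w. fd g w (S w)" k] eq by metis

lemma euler_relation:
  fixes f :: "'a::euclidean_space \<times> 'a \<Rightarrow> real"
  assumes f: "f differentiable (at (x, y))" and hom: "\<And>r. r > 0 \<Longrightarrow> f (x, r *\<^sub>R y) = r * f (x, y)"
  shows "fd f (x, y) (0, y) = f (x, y)"
proof -
  have "((\<lambda>t::real. (x, t *\<^sub>R y)) has_derivative (\<lambda>t. (0, t *\<^sub>R y))) (at 1)"
    by (auto intro!: derivative_eq_intros)
  from has_derivative_compose[OF this, of f "fd f (x, y)"] has_fd[OF f]
  have "((\<lambda>t::real. f (x, t *\<^sub>R y)) has_derivative (\<lambda>t. fd f (x, y) (0, t *\<^sub>R y))) (at 1)" by simp
  moreover have "((\<lambda>t::real. f (x, t *\<^sub>R y)) has_derivative (\<lambda>t. t * f (x, y))) (at 1)"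
    by (rule has_derivative_transform_within_open[where s="{0<..}" and f="\<lambda>t. t * f (x, y)"])
      (auto simp: hom intro!: derivative_eq_intros)
  ultimately have "(\<lambda>t::real. fd f (x, y) (0, t *\<^sub>R y)) = (\<lambda>t. t * f (x, y))" by (rule has_derivative_unique)
  from fun_cong[OF this, of 1] show ?thesis by simp
qed

lemma fd_square:
  fixes f :: "'a::euclidean_space \<Rightarrow> real"
  assumes "f differentiable (at w)" shows "fd (\<lambda>w. (f w)\<^sup>2) w v = 2 * f w * fd f w v"
proof -
  have "((\<lambda>w. (f w)\<^sup>2) has_derivative (\<lambda>v. 2 * f w * fd f w v)) (at w)"
    using has_fd[OF assms] by (auto intro!: derivative_eq_intros)
  from fd_eqI[OF this] show ?thesis by simp
qed

text \<open>By the energy identity the derivative of \<open>f\<close> along \<open>S\<close>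
  vanishes, so the factor \<open>2 * f w\<close> comes out of the Lagrange equation for the square
  and is divided away. The vertical derivatives of \<open>f\<close> are 0-homogeneous, hence have
  derivative zero in the Liouville direction, and \<open>S\<close> may be replaced by
  \<open>S0\<close>.\<close>

lemma rapcsak_from_energy:
  fixes f :: "'a::euclidean_space \<times> 'a \<Rightarrow> real"
  assumes \<Omega>: "open \<Omega>" "w \<in> \<Omega>" and f: "smooth_on \<Omega> f" and nz: "\<And>w. w \<in> \<Omega> \<Longrightarrow> f w \<noteq> 0"
    and euler: "\<And>w. w \<in> \<Omega> \<Longrightarrow> fd f w (0, snd w) = f w"
    and S: "S = S0 - c *\<^sub>R (0, snd w)"
    and energy: "fd (\<lambda>w. (f w)\<^sup>2) w S = 0"
    and lagrange: "fd (\<lambda>w. fd (\<lambda>w. (f w)\<^sup>2) w (0, e)) w S = fd (\<lambda>w. (f w)\<^sup>2) w (e, 0)"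
  shows "fd (\<lambda>w. fd f w (0, e)) w S0 = fd f w (e, 0)"
proof -
  have d: "f differentiable (at w)" if "w \<in> \<Omega>" for w using smooth_on_differentiable[OF f that] .
  have f1: "smooth_on \<Omega> (\<lambda>w. fd f w (0, e))" by (rule smooth_on_fd[OF f])
  have fS: "fd f w S = 0" using energy fd_square[OF d[OF \<Omega>(2)], of S] nz[OF \<Omega>(2)] by simp
  have "fd (\<lambda>w. fd (\<lambda>w. (f w)\<^sup>2) w (0, e)) w = fd (\<lambda>w. 2 * f w * fd f w (0, e)) w"
    by (rule fd_cong[OF \<Omega>]) (rule fd_square[OF d])
  moreover have "((\<lambda>w. 2 * f w * fd f w (0, e)) has_derivative
      (\<lambda>v. 2 * f w * fd (\<lambda>w. fd f w (0, e)) w v + 2 * fd f w v * fd f w (0, e))) (at w)"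
    using smooth_on_has_fd[OF f \<Omega>(2)] smooth_on_has_fd[OF f1 \<Omega>(2)] by (auto intro!: derivative_eq_intros)
  ultimately have "fd (\<lambda>w. fd (\<lambda>w. (f w)\<^sup>2) w (0, e)) w S = 2 * f w * fd (\<lambda>w. fd f w (0, e)) w S"
    using fS by (simp add: fd_eqI)
  then have 1: "fd (\<lambda>w. fd f w (0, e)) w S = fd f w (e, 0)"
    using lagrange fd_square[OF d[OF \<Omega>(2)], of "(e, 0)"] nz[OF \<Omega>(2)] by simp
  have L: "linear (fd (\<lambda>w. fd f w (0, e)) w)" by (rule smooth_on_linear_fd[OF f1 \<Omega>(2)])
  have C: "bounded_linear (\<lambda>w :: 'a \<times> 'a. (0 :: 'a, snd w))"
    by (intro bounded_linear_Pair bounded_linear_zero bounded_linear_snd)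
  \<comment> \<open>Euler's identity differentiated in the vertical direction \<open>e\<close>: the
    term from the Liouville field equals the right-hand side and leaves zero.\<close>
  have "fd (\<lambda>y. fd f y (0, e)) w (0, snd w) + fd f w (fd (\<lambda>w. (0, snd w)) w (0, e)) = fd f w (0, e)"
    by (rule fd_along_equation[OF \<Omega> f smooth_on_bounded_linear[OF C]]) (rule euler)
  moreover have "fd (\<lambda>w :: 'a \<times> 'a. (0 :: 'a, snd w)) w (0, e) = (0, e)"
    using fd_eqI[OF bounded_linear_imp_has_derivative[OF C], of w] by simp
  ultimately have "fd (\<lambda>w. fd f w (0, e)) w (0, snd w) = 0" by simp
  then have "fd (\<lambda>w. fd f w (0, e)) w S = fd (\<lambda>w. fd f w (0, e)) w S0"
    unfolding S by (simp only: linear_diff[OF L] linear_scale[OF L]) simp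
  with 1 show ?thesis by simp
qed

lemma positive_affine_const:
  fixes u :: "real \<Rightarrow> real"
  assumes u: "\<And>t. (u has_real_derivative c) (at t)" and pos: "\<And>t. u t > 0"
  shows "u t = u 0"
proof -
  have "((\<lambda>t. u t - c * t) has_real_derivative 0) (at t)" for t
    using u[of t] by (auto intro!: derivative_eq_intros)
  then have lin: "u t = u 0 + c * t" for t
    using DERIV_isconst_all[of "\<lambda>t. u t - c * t" t 0] by simp
  have "c = 0"
  proof (rule ccontr)
    assume "c \<noteq> 0"
    then have "u (- u 0 / c) = 0" using lin[of "- u 0 / c"] by simp
    then show False using pos[of "- u 0 / c"] by simp
  qed
  then show ?thesis using lin[of t] by simp
qed

text \<open>The vertical part \<open>-2G\<close> of the spray.\<close>

definition twisted_force :: "'n \<Rightarrow> 'n \<Rightarrow> 'n \<Rightarrow> (real ^ 'n) \<times> (real ^ 'n) \<Rightarrow> real ^ 'n" where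
  "twisted_force i j k w = (- 2 * fst w $ j * (snd w $ k * snd w $ k)) *\<^sub>R axis i 1"

lemma smooth_on_twisted_force: "open S \<Longrightarrow> smooth_on S (twisted_force i j k)"
  unfolding twisted_force_def
  by (intro smooth_on_scaleR smooth_on_mult smooth_on_const
    smooth_on_bounded_linear[OF bounded_linear_compose[OF bounded_linear_vec_nth bounded_linear_fst]]
    smooth_on_bounded_linear[OF bounded_linear_compose[OF bounded_linear_vec_nth bounded_linear_snd]])

text \<open>Positivity and homogeneity are assumed on full fibres over \<open>U\<close>, since the
  argument ends on a line in the fibre over \<open>a\<close>. The hypothesis \<open>eq\<close> is
  Rapcsak's equation.\<close>

lemma twisted_spray_not_variational:
  fixes f :: "(real ^ 'n) \<times> (real ^ 'n) \<Rightarrow> real"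
  assumes U: "open U" "a \<in> U" and ij: "i \<noteq> j" "k \<noteq> i" "k \<noteq> j"
  defines "\<Omega> \<equiv> U \<times> (- {0})"
  assumes f: "smooth_on \<Omega> f" and pos: "\<And>w. w \<in> \<Omega> \<Longrightarrow> f w > 0"
    and hom: "\<And>x y r. x \<in> U \<Longrightarrow> y \<noteq> 0 \<Longrightarrow> r > 0 \<Longrightarrow> f (x, r *\<^sub>R y) = r * f (x, y)"
    and eq: "\<And>w l. w \<in> \<Omega> \<Longrightarrow>
      fd (\<lambda>w. fd f w (0, axis l 1)) w (snd w, twisted_force i j k w) = fd f w (axis l 1, 0)"
  shows False
proof -
  define S where "S w = (snd w, twisted_force i j k w)" for w
  define X where "X l = (axis l 1 :: real ^ 'n, 0 :: real ^ 'n)" for l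
  define Y where "Y l = (0 :: real ^ 'n, axis l 1 :: real ^ 'n)" for l
  define fy where "fy l w = fd f w (Y l)" for l w
  define fx where "fx l w = fd f w (X l)" for l w
  have \<Omega>: "open \<Omega>" unfolding \<Omega>_def using U by (intro open_Times) auto
  have fy: "smooth_on \<Omega> (fy l)" and fx: "smooth_on \<Omega> (fx l)" for l
    unfolding fx_def fy_def by (rule smooth_on_fd[OF f])+
  have S: "smooth_on \<Omega> S"
    unfolding S_def by (intro smooth_on_Pair \<Omega> smooth_on_twisted_force smooth_on_bounded_linear bounded_linear_snd)
  have S': "fd S w v = (snd v, (- 2 * (fst v $ j * (snd w $ k * snd w $ k) + fst w $ j * (2 * snd w $ k * snd v $ k))) *\<^sub>R axis i 1)" for w v
  proof -
    have nth: "((\<lambda>w. fst w $ l) has_derivative (\<lambda>v. fst v $ l)) (at w)"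
      "((\<lambda>w. snd w $ l) has_derivative (\<lambda>v. snd v $ l)) (at w)" for l and w :: "(real ^ 'n) \<times> (real ^ 'n)"
      by (rule bounded_linear_imp_has_derivative[OF bounded_linear_compose[OF bounded_linear_vec_nth bounded_linear_fst]]
        bounded_linear_imp_has_derivative[OF bounded_linear_compose[OF bounded_linear_vec_nth bounded_linear_snd]])+
    have "(S has_derivative (\<lambda>v. (snd v, (- 2 * (fst v $ j * (snd w $ k * snd w $ k) + fst w $ j * (2 * snd w $ k * snd v $ k))) *\<^sub>R axis i 1))) (at w)"
      unfolding S_def twisted_force_def
      by (rule derivative_eq_intros nth refl | simp add: algebra_simps)+
    from fd_eqI[OF this] show ?thesis by simp
  qed
  \<comment> \<open>These are the commutators of the coordinate directions with \<open>S\<close>.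
    The force depends on x through coordinate j and on y through coordinate k only; as k differs
    from i and j, among the four directions used below only \<open>X j\<close> produces a force
    term.\<close>
  have SY: "fd S w (Y l) = X l" if "l \<noteq> k" for l w
    using that by (simp add: S' X_def Y_def axis_def)
  have SXi: "fd S w (X i) = 0" for w
    using ij by (simp add: S' X_def axis_def zero_prod_def)
  have SXj: "fd S w (X j) = (- 2 * (snd w $ k * snd w $ k)) *\<^sub>R Y i" for w
    by (simp add: S' X_def Y_def)
  have eq': "fd (fy l) w (S w) = fx l w" if "w \<in> \<Omega>" for l w
    using eq[OF that, of l] by (simp add: fy_def[abs_def] fx_def S_def X_def Y_def)
  note diff = fd_along_equation[OF \<Omega> _ fy S eq']
  have comm: "fd (\<lambda>w. fd f w u) w v = fd (\<lambda>w. fd f w v) w u" if "w \<in> \<Omega>" for u v w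
    by (rule fd_fd_commute[OF \<Omega> that f])
  \<comment> \<open>With a, b for the two sides and s for the common third-order term, the two
    differentiated equations read s + a = b and s + b = a, whence a = b.\<close>
  have III: "fd (fy i) w (X j) = fd (fy j) w (X i)" if w: "w \<in> \<Omega>" for w
  proof -
    have "fd (\<lambda>w. fd (fy i) w (Y j)) w (S w) + fd (fy i) w (X j) = fd (fx i) w (Y j)"
      using diff[OF w, of i "Y j"] ij by (simp add: SY)
    moreover have "fd (\<lambda>w. fd (fy j) w (Y i)) w (S w) + fd (fy j) w (X i) = fd (fx j) w (Y i)"
      using diff[OF w, of j "Y i"] ij by (simp add: SY)
    moreover have "fd (fx i) w (Y j) = fd (fy j) w (X i)" "fd (fx j) w (Y i) = fd (fy i) w (X j)"
      unfolding fx_def fy_def by (rule comm[OF w])+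
    moreover have "fd (\<lambda>w. fd (fy i) w (Y j)) w = fd (\<lambda>w. fd (fy j) w (Y i)) w"
      by (rule fd_cong[OF \<Omega> w]) (unfold fy_def, rule comm)
    ultimately show ?thesis by simp
  qed
  \<comment> \<open>\<open>III\<close> holds on an open set, so it may be differentiated along
    \<open>S\<close>. The equation for i along \<open>X j\<close> and the equation for j along
    \<open>X i\<close> then share the leading term and the right-hand side, and differ only by the
    contribution of \<open>SXj\<close>.\<close>
  have vanish: "fd (fy i) w (Y i) = 0" if w: "w \<in> \<Omega>" and k: "snd w $ k \<noteq> 0" for w
  proof -
    have L: "linear (fd (fy l) w)" for l by (rule smooth_on_linear_fd[OF fy w])
    have "fd (\<lambda>w. fd (fy i) w (X j)) w (S w) - 2 * (snd w $ k * snd w $ k) * fd (fy i) w (Y i) = fd (fx i) w (X j)"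
      using diff[OF w, of i "X j"] by (simp only: SXj linear_scale[OF L]) simp
    moreover have "fd (\<lambda>w. fd (fy j) w (X i)) w (S w) = fd (fx j) w (X i)"
      using diff[OF w, of j "X i"] by (simp add: SXi linear_0[OF L])
    moreover have "fd (fx j) w (X i) = fd (fx i) w (X j)"
      unfolding fx_def by (rule comm[OF w])
    moreover have "fd (\<lambda>w. fd (fy i) w (X j)) w = fd (\<lambda>w. fd (fy j) w (X i)) w"
      by (rule fd_cong[OF \<Omega> w]) (rule III)
    ultimately show ?thesis using k by simp
  qed
  \<comment> \<open>On this line y^k stays 1, so the line avoids the zero vector and
    \<open>vanish\<close> applies at each of its points.\<close>
  define p where "p t = (a, axis k 1) + t *\<^sub>R Y i" for t
  have p_snd: "snd (p t) $ k = 1" for t using ij by (simp add: p_def Y_def axis_def)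
  have p\<Omega>: "p t \<in> \<Omega>" for t
  proof -
    have "snd (p t) \<noteq> 0" using p_snd[of t] by force
    then show ?thesis using U by (simp add: \<Omega>_def p_def Y_def mem_Times_iff)
  qed
  have "((\<lambda>t. fy i (p t)) has_real_derivative 0) (at t)" for t
  proof -
    have "fd (fy i) (p t) (Y i) = 0" by (rule vanish[OF p\<Omega>]) (simp add: p_snd)
    then show ?thesis
      using has_real_derivative_along_line[of "fy i" "(a, axis k 1)" t "Y i"] smooth_on_differentiable[OF fy p\<Omega>[of t], of i]
      unfolding p_def by simp
  qed
  then have const: "fy i (p t) = fy i (p 0)" for t using DERIV_isconst_all[of "\<lambda>t. fy i (p t)" t 0] by simp
  have "((\<lambda>t. f (p t)) has_real_derivative fy i (p 0)) (at t)" for t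
    using has_real_derivative_along_line[of f "(a, axis k 1)" t "Y i"] smooth_on_differentiable[OF f p\<Omega>[of t]] const[of t]
    unfolding p_def fy_def by simp
  then have fp: "f (p t) = f (p 0)" for t using positive_affine_const[of "\<lambda>t. f (p t)" "fy i (p 0)"] pos[OF p\<Omega>] by blast
  have a\<Omega>: "(a, axis i 1) \<in> \<Omega>" using U by (simp add: \<Omega>_def)
  \<comment> \<open>Here e_i + s e_k = s (e_k + e_i / s), so homogeneity gives \<open>s\<close>
    times the constant value on the line. As \<open>s\<close> tends to 0 from above the point
    reaches e_i, where \<open>f\<close> is continuous and positive.\<close>
  have scaled: "f (a, axis i 1 + s *\<^sub>R axis k 1) = s * f (p 0)" if s: "s > 0" for s
  proof -
    have "(a, axis i 1 + s *\<^sub>R axis k 1) = (fst (p (inverse s)), s *\<^sub>R snd (p (inverse s)))"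
      using s by (simp add: p_def Y_def scaleR_add_right)
    moreover have "fst (p (inverse s)) \<in> U" "snd (p (inverse s)) \<noteq> 0" using p\<Omega>[of "inverse s"] by (auto simp: \<Omega>_def mem_Times_iff)
    ultimately show ?thesis using hom[of "fst (p (inverse s))" "snd (p (inverse s))" s] s fp[of "inverse s"] by simp
  qed
  have "isCont f (a, axis i 1)"
    using smooth_on_differentiable[OF f a\<Omega>] by (rule differentiable_imp_continuous_within)
  moreover have "((\<lambda>s. (a, axis i 1 + s *\<^sub>R axis k 1)) \<longlongrightarrow> (a, axis i (1::real) + 0 *\<^sub>R axis k 1)) (at_right (0::real))"
    by (intro tendsto_intros)
  ultimately have "((\<lambda>s. f (a, axis i 1 + s *\<^sub>R axis k 1)) \<longlongrightarrow> f (a, axis i 1)) (at_right 0)"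
    using isCont_tendsto_compose[of "(a, axis i 1)" f] by simp
  moreover have "((\<lambda>s. f (a, axis i 1 + s *\<^sub>R axis k 1)) \<longlongrightarrow> 0) (at_right 0)"
  proof (rule Lim_transform_eventually)
    have "((\<lambda>s. s * f (p 0)) \<longlongrightarrow> 0 * f (p 0)) (at_right 0)" by (intro tendsto_intros)
    then show "((\<lambda>s. s * f (p 0)) \<longlongrightarrow> 0) (at_right 0)" by simp
    show "\<forall>\<^sub>F s in at_right 0. s * f (p 0) = f (a, axis i 1 + s *\<^sub>R axis k 1)"
      using scaled by (auto simp: eventually_at_filter)
  qed
  ultimately have "f (a, axis i 1) = 0" by (intro tendsto_unique[OF _]) auto
  then show False using pos[OF a\<Omega>] by simp
qed

section \<open>Geodesic sprays in a chart\<close>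

context manifold_atlas
begin

lemma d_vform_chart:
  assumes f: "smooth_fun (slit_atlas A) f" and Y: "Y z \<in> tangent_space (slit_atlas A) z"
    and k: "k \<in> slit_atlas A" "z \<in> fst k"
  shows "d_vform (slit_atlas A) tangent_structure f Y z = fd (f \<circ> chart_inv k) (snd k z) (0, fst (Y z k))"
proof -
  have "(f \<circ> chart_inv k) differentiable (at (snd k z))"
    by (rule smooth_on_differentiable[OF slit.smooth_funD[OF f k(1)]]) (use k in \<open>auto simp: chart_image_def\<close>)
  from slit.vf_deriv_chart[where X="tangent_structure Y", OF k tangent_structure_tangent[of Y, OF Y] this]
  show ?thesis by (simp add: d_vform_def tangent_structure_def)
qed

text \<open>Smoothness of \<open>f\<close> and of the fields lets every derivative in
  \<open>ext_d1\<close> be computed in the one chart \<open>k\<close>; the bracket term is covered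
  because the bracket is tangent.\<close>

lemma ext_d1_d_vform_chart:
  assumes f: "smooth_fun (slit_atlas A) f" and X: "X \<in> vector_fields (slit_atlas A)" and Y: "Y \<in> vector_fields (slit_atlas A)"
    and k: "k \<in> slit_atlas A" "z \<in> fst k"
  defines "g \<equiv> f \<circ> chart_inv k"
  shows "ext_d1 (slit_atlas A) (d_vform (slit_atlas A) tangent_structure f) X Y z =
    fd (\<lambda>w. fd g w (0, fst (local_rep Y k w))) (snd k z) (X z k)
    - fd (\<lambda>w. fd g w (0, fst (local_rep X k w))) (snd k z) (Y z k)
    - fd g (snd k z) (0, fst (bracket (slit_atlas A) X Y z k))"
proof -
  let ?\<alpha> = "d_vform (slit_atlas A) tangent_structure f"
  have o: "open (chart_image k)" by (rule slit.open_chart_image[OF k(1)])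
  have wi: "snd k z \<in> chart_image k" using k(2) unfolding chart_image_def by (rule imageI)
  have g: "smooth_on (chart_image k) g" unfolding g_def by (rule slit.smooth_funD[OF f k(1)])
  have "vf_deriv (slit_atlas A) X' (?\<alpha> Z) z = fd (\<lambda>w. fd g w (0, fst (local_rep Z k w))) (snd k z) (X' z k)"
    if Z: "Z \<in> vector_fields (slit_atlas A)" and X': "X' \<in> vector_fields (slit_atlas A)" for Z X'
  proof -
    have e: "(?\<alpha> Z \<circ> chart_inv k) w = fd g w (0, fst (local_rep Z k w))" if w: "w \<in> chart_image k" for w
    proof -
      obtain z' where z': "z' \<in> fst k" "w = snd k z'" "chart_inv k w = z'" using slit.chart_image_cases[OF k(1) w] .
      show ?thesis
        using d_vform_chart[where Y=Z, OF f slit.vector_fields_tangent[OF Z k(1) z'(1)] k(1) z'(1)] z'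
        by (simp add: g_def local_rep_def)
    qed
    have "smooth_on (chart_image k) (\<lambda>w. fd g w (0, fst (local_rep Z k w)))"
      by (intro smooth_on_fd_field o g smooth_on_Pair smooth_on_const smooth_on_fst slit.vector_fields_smooth[OF Z k(1)])
    then have "smooth_on (chart_image k) (?\<alpha> Z \<circ> chart_inv k)" by (rule smooth_on_eqI[OF o]) (rule e)
    from slit.vf_deriv_chart[where X=X', OF k slit.vector_fields_tangent[OF X' k] smooth_on_differentiable[OF this wi]]
    show ?thesis using fd_cong[OF o wi e] by simp
  qed
  note this[OF Y X] this[OF X Y]
  moreover have "?\<alpha> (bracket (slit_atlas A) X Y) z = fd g (snd k z) (0, fst (bracket (slit_atlas A) X Y z k))"
    unfolding g_def by (rule d_vform_chart[where Y="bracket (slit_atlas A) X Y", OF f slit.bracket_tangent[OF X Y] k])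
  ultimately show ?thesis by (simp add: ext_d1_def)
qed

lemma spray_fst:
  assumes S: "spray A S" and c: "c \<in> A" and z: "z \<in> fst (slit_chart A c)"
  shows "fst (S z (slit_chart A c)) = snd z c"
proof -
  have "tangent_structure S z (slit_chart A c) = liouville A z (slit_chart A c)"
    using S z unfolding spray_def by (simp add: fst_slit_chart)
  then show ?thesis using c z by (simp add: tangent_structure_def liouville_def)
qed

text \<open>The defining equation is tested on two kinds of fields: on \<open>S\<close> itself it
  gives conservation of energy, on a coordinate field \<open>(e, 0)\<close> the Euler-Lagrange
  equation. Forms act on global fields, so the coordinate field is cut off by \<open>\<psi>\<close>,
  which is 1 over \<open>U\<close>.\<close>

lemma geodesic_spray_chart:
  assumes geo: "geodesic_spray A F S" and F: "smooth_fun (slit_atlas A) F"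
    and c: "c \<in> A" and U: "open U" "U \<subseteq> chart_image c"
    and \<psi>: "cutoff c \<psi>" "\<And>x. x \<in> U \<Longrightarrow> \<psi> (chart_inv c x) = 1"
  defines "k \<equiv> slit_chart A c"
  defines "f \<equiv> F \<circ> chart_inv k"
  assumes euler: "\<And>w. w \<in> U \<times> (- {0}) \<Longrightarrow> fd f w (0, snd w) = f w"
    and w: "w \<in> U \<times> (- {0})"
  shows "fd (\<lambda>w. (f w)\<^sup>2) w (local_rep S k w) = 0"
    and "fd (\<lambda>w. fd (\<lambda>w. (f w)\<^sup>2) w (0, e)) w (local_rep S k w) = fd (\<lambda>w. (f w)\<^sup>2) w (e, 0)"
proof -
  let ?B = "slit_atlas A"
  let ?\<Omega> = "U \<times> (- {0 :: 'e})"
  define g where "g = (\<lambda>w. (f w)\<^sup>2)"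
  have k: "k \<in> ?B" using c by (simp add: k_def)
  have ci: "chart_image k = chart_image c \<times> (- {0})" unfolding k_def by (rule slit_chart_image[OF c])
  have \<Omega>: "open ?\<Omega>" "?\<Omega> \<subseteq> chart_image k" using U by (auto simp: ci intro!: open_Times)
  have wk: "w \<in> chart_image k" using w \<Omega> by blast
  have ok: "open (chart_image k)" by (rule slit.open_chart_image[OF k])
  have F2: "smooth_fun ?B (\<lambda>z. (F z)\<^sup>2)" unfolding power2_eq_square by (rule slit.smooth_fun_mult[OF F F])
  have g_eq: "g = (\<lambda>z. (F z)\<^sup>2) \<circ> chart_inv k" by (auto simp: g_def f_def)
  have f: "smooth_on (chart_image k) f" unfolding f_def by (rule slit.smooth_funD[OF F k])
  have g: "smooth_on (chart_image k) g" unfolding g_eq by (rule slit.smooth_funD[OF F2 k])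
  have S: "spray A S" and Sv: "S \<in> vector_fields ?B" using geo by (auto simp: geodesic_spray_def spray_def)
  have fstS: "fst (local_rep S k w) = snd w" if wk': "w \<in> chart_image k" for w
  proof -
    obtain z where z: "z \<in> fst k" "w = snd k z" "chart_inv k w = z" using slit.chart_image_cases[OF k wk'] .
    then show ?thesis using spray_fst[OF S c, of z] by (simp add: local_rep_def k_def)
  qed
  have euler2: "fd g w (0, fst (local_rep S k w)) = 2 * g w" if w': "w \<in> ?\<Omega>" for w
  proof -
    have "f differentiable (at w)" by (rule smooth_on_differentiable[OF f]) (use w' \<Omega> in blast)
    then have "fd g w (0, snd w) = 2 * f w * fd f w (0, snd w)" unfolding g_def by (rule fd_square)
    moreover have "fst (local_rep S k w) = snd w" by (rule fstS) (use w' \<Omega> in blast)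
    ultimately show ?thesis using euler[OF w'] by (simp add: g_def power2_eq_square)
  qed
  \<comment> \<open>By Euler, d_J F^2 takes the value 2 F^2 on a spray, so the second term of the
    exterior derivative is twice the differential of F^2.\<close>
  have "fd (\<lambda>w. fd g w (0, fst (local_rep S k w))) w = fd (\<lambda>w. 2 * g w) w"
    by (rule fd_cong[OF \<Omega>(1) w]) (rule euler2)
  moreover have "((\<lambda>w. 2 * g w) has_derivative (\<lambda>v. 2 * fd g w v)) (at w)"
    by (rule has_derivative_mult_right[OF smooth_on_has_fd[OF g wk]])
  ultimately have eS: "fd (\<lambda>w. fd g w (0, fst (local_rep S k w))) w v = 2 * fd g w v" for v
    by (simp add: fd_eqI)
  obtain z where z: "z \<in> fst k" "w = snd k z" "chart_inv k w = z" using slit.chart_image_cases[OF k wk] .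
  have zs: "z \<in> slit_bundle A" using z(1) by (simp add: k_def fst_slit_chart)
  have main: "fd (\<lambda>w. fd g w (0, fst (local_rep Y k w))) w (local_rep S k w)
      = fd g w (Y z k) + fd g w (0, fst (bracket ?B S Y z k))" if Y: "Y \<in> vector_fields ?B" for Y
  proof -
    have "ddJ_sq A F S Y z = - vf_deriv ?B Y (\<lambda>z. (F z)\<^sup>2) z"
      using geo Y zs unfolding geodesic_spray_def by blast
    also have "vf_deriv ?B Y (\<lambda>z. (F z)\<^sup>2) z = fd g w (Y z k)"
      unfolding g_eq z(2) by (rule slit.vf_deriv_chart[where X=Y, OF k z(1) slit.vector_fields_tangent[OF Y k z(1)]])
        (use smooth_on_differentiable[OF g wk] in \<open>simp add: g_eq z(2)\<close>)
    finally show ?thesis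
      using ext_d1_d_vform_chart[OF F2 Sv Y k z(1), folded g_eq] eS[of "Y z k"] z(3)
      by (simp add: ddJ_sq_def local_rep_def flip: z(2))
  qed
  \<comment> \<open>For \<open>Y = S\<close> the bracket drops out and \<open>main\<close> reads 2
    S(g) = S(g).\<close>
  have "bracket ?B S S z k = 0" by (simp add: bracket_def)
  then have "fd g w (local_rep S k w) = 0"
    using main[OF Sv] eS[of "local_rep S k w"] linear_0[OF smooth_on_linear_fd[OF g wk]] z(3)
    by (simp add: local_rep_def flip: zero_prod_def)
  then show "fd (\<lambda>w. (f w)\<^sup>2) w (local_rep S k w) = 0" by (simp add: g_def)
  define Y where "Y = slit_cutoff_field c \<psi> (\<lambda>_. (e, 0))"
  have Y: "Y \<in> vector_fields ?B" unfolding Y_def by (rule slit_cutoff_field[OF c \<psi>(1) smooth_on_const])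
  have Yk: "local_rep Y k v = (e, 0)" if v: "v \<in> ?\<Omega>" for v
  proof -
    obtain z where z: "z \<in> fst k" "v = snd k z" "chart_inv k v = z"
      using slit.chart_image_cases[OF k, of v] v \<Omega> by blast
    have "chart_inv c (fst v) = fst z"
      using z c by (simp add: k_def fst_slit_chart)
    moreover have "\<psi> (chart_inv c (fst v)) = 1" by (rule \<psi>(2)) (use v in auto)
    ultimately show ?thesis
      using slit.cutoff_field_chart[OF k z(1), of "\<lambda>z. \<psi> (fst z)" "\<lambda>_. (e, 0)"]
      by (simp add: local_rep_def Y_def z(3) flip: k_def)
  qed
  have Yz: "Y z k = (e, 0)" using Yk[OF w] z(3) by (simp add: local_rep_def)
  have "fd (local_rep Y k) w = fd (\<lambda>_. (e, 0)) w" by (rule fd_cong[OF \<Omega>(1) w Yk])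
  then have "bracket ?B S Y z k = - fd (local_rep S k) w (e, 0)"
    using k z(1) Yz by (simp add: bracket_def frechet_derivative_const flip: z(2))
  \<comment> \<open>The first component of a spray is y, which does not vary with x; so the bracket
    with a coordinate field is vertical and d_J annihilates it.\<close>
  moreover have "fst (fd (local_rep S k) w (e, 0)) = 0"
  proof -
    have "((\<lambda>w. fst (local_rep S k w)) has_derivative (\<lambda>v. fst (fd (local_rep S k) w v))) (at w)"
      by (rule has_derivative_fst[OF smooth_on_has_fd[OF slit.vector_fields_smooth[OF Sv k] wk]])
    then have "(snd has_derivative (\<lambda>v. fst (fd (local_rep S k) w v))) (at w)"
      by (rule has_derivative_transform_within_open[OF _ ok wk]) (rule fstS)
    then have "(\<lambda>v. fst (fd (local_rep S k) w v)) = snd"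
      using has_derivative_unique bounded_linear_imp_has_derivative[OF bounded_linear_snd] by blast
    from fun_cong[OF this, of "(e, 0)"] show ?thesis by simp
  qed
  ultimately have "fd g w (0, fst (bracket ?B S Y z k)) = 0"
    using linear_0[OF smooth_on_linear_fd[OF g wk]] by (simp flip: zero_prod_def)
  moreover have "fd (\<lambda>w. fd g w (0, fst (local_rep Y k w))) w = fd (\<lambda>w. fd g w (0, e)) w"
    by (rule fd_cong[OF \<Omega>(1) w]) (simp add: Yk)
  ultimately show "fd (\<lambda>w. fd (\<lambda>w. (f w)\<^sup>2) w (0, e)) w (local_rep S k w) = fd (\<lambda>w. (f w)\<^sup>2) w (e, 0)"
    using main[OF Y] Yz by (simp add: g_def)
qed

end

theorem proposition3p3:
  fixes A :: "('m::{t2_space, second_countable_topology}, real ^ 'n) chart set"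
  assumes "smooth_manifold A"
    and "connected (UNIV :: 'm set)"
    and "CARD('n) \<ge> 3"
  shows "\<exists>S\<^sub>0. spray A S\<^sub>0 \<and>
           \<not> (\<exists>S \<in> projective_class A S\<^sub>0.
                finsler_metrizable A S \<and> same_jacobi_endomorphism A S S\<^sub>0)"
proof -
  interpret manifold_atlas A by standard (rule assms(1))
  obtain T :: "'n set" where "card T = 3" using obtain_subset_with_card_n[OF assms(3)] by blast
  then obtain i j k where T: "i \<noteq> j" "k \<noteq> i" "k \<noteq> (j :: 'n)" by (auto simp: card_3_iff)
  \<comment> \<open>\<open>undefined\<close> serves as an arbitrary point; the manifold is the whole
    type, hence nonempty.\<close>
  obtain c where c: "c \<in> A" "undefined \<in> fst c" using covers by blast
  have oW: "open (chart_image c \<times> (- {0 :: real ^ 'n}))" using base.open_chart_image[OF c(1)] by (intro open_Times) auto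
  have "twisted_force i j k (x, r *\<^sub>R y) = (r * r) *\<^sub>R twisted_force i j k (x, y)" for x y r
    by (simp add: twisted_force_def)
  from spray_extension[OF c smooth_on_twisted_force[OF oW] this]
  obtain S0 N where S0: "spray A S0" and N: "open N" "undefined \<in> N" "N \<subseteq> fst c"
    and S0_eq: "\<And>z. z \<in> fst (slit_chart A c) \<Longrightarrow> fst z \<in> N \<Longrightarrow>
      S0 z (slit_chart A c) = (snd z c, twisted_force i j k (snd (slit_chart A c) z))" by metis
  \<comment> \<open>Over \<open>N\<close> the spray is explicit, over \<open>N1\<close> the cutoff
    of the test fields is 1; the argument runs over the part of the chart where both hold.\<close>
  obtain \<psi> N1 where \<psi>: "cutoff c \<psi>" and N1: "open N1" "undefined \<in> N1" "\<And>q. q \<in> N1 \<Longrightarrow> \<psi> q = 1"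
    using cutoff_exists[OF c] by metis
  define K where "K = slit_chart A c"
  define U where "U = snd c ` (fst c \<inter> (N \<inter> N1))"
  have U: "open U" "U \<subseteq> chart_image c" "snd c undefined \<in> U"
    using open_chart_image_set[OF c(1), of "N \<inter> N1"] N N1 c by (auto simp: U_def chart_image_def)
  have UN: "chart_inv c x \<in> N \<inter> N1" if "x \<in> U" for x
    using that base.chart_inv_chart[OF c(1)] by (auto simp: U_def)
  have K: "K \<in> slit_atlas A" using c by (simp add: K_def)
  let ?\<Omega> = "U \<times> (- {0 :: real ^ 'n})"
  have \<Omega>: "open ?\<Omega>" "?\<Omega> \<subseteq> chart_image K"
    using U slit_chart_image[OF c(1)] by (auto simp: K_def intro!: open_Times)
  have "\<not> finsler_metrizable A S" if S: "S \<in> projective_class A S0" for S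
  proof
    assume "finsler_metrizable A S"
    then obtain F where F: "finsler_function A F" and geo: "geodesic_spray A F S"
      unfolding finsler_metrizable_def by blast
    obtain P where P: "\<And>z. z \<in> slit_bundle A \<Longrightarrow> S z = (\<lambda>k. S0 z k - (2 * P z) *\<^sub>R liouville A z k)"
      using S unfolding projective_class_def by blast
    have Fs: "smooth_fun (slit_atlas A) F" using F by (simp add: finsler_function_def)
    define f where "f = F \<circ> chart_inv K"
    have f: "smooth_on ?\<Omega> f"
      unfolding f_def by (rule smooth_on_subset[OF slit.smooth_funD[OF Fs K] \<Omega>(2)])
    have point: "\<exists>z. z \<in> fst K \<and> w = snd K z \<and> chart_inv K w = z \<and> z \<in> slit_bundle A \<and> fst z \<in> N" if w: "w \<in> ?\<Omega>" for w
    proof -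
      obtain z where z: "z \<in> fst K" "w = snd K z" "chart_inv K w = z"
        using slit.chart_image_cases[OF K, of w] w \<Omega>(2) by blast
      have "chart_inv c (fst w) = fst z" "z \<in> slit_bundle A" using z c by (simp_all add: K_def fst_slit_chart)
      moreover have "chart_inv c (fst w) \<in> N" using UN[of "fst w"] w by auto
      ultimately show ?thesis using z by metis
    qed
    have pos: "f w > 0" if w: "w \<in> ?\<Omega>" for w
    proof -
      obtain z where z: "chart_inv K w = z" "z \<in> slit_bundle A" using point[OF w] by blast
      then have "z \<in> tangent_bundle A" "snd z \<noteq> (\<lambda>_. 0)" by (auto simp: slit_bundle_def)
      then have "F z \<ge> 0" "F z \<noteq> 0" using F unfolding finsler_function_def by blast+
      then show ?thesis using z by (simp add: f_def)
    qed
    have hom: "f (x, r *\<^sub>R y) = r * f (x, y)" if x: "x \<in> U" and y: "y \<noteq> 0" and r: "r > 0" for x y r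
    proof -
      obtain z where z: "z \<in> fst K" "(x, y) = snd K z" "chart_inv K (x, y) = z" "z \<in> slit_bundle A"
        using point[of "(x, y)"] x y by auto
      have "snd K (fibre_scale r z) = (x, r *\<^sub>R y)" using fibre_scale(3)[OF z(4) r, of c] z(2) by (simp add: K_def)
      then have "chart_inv K (x, r *\<^sub>R y) = fibre_scale r z"
        using slit.chart_inv_chart[OF K, of "fibre_scale r z"] fibre_scale(2)[OF z(4) r, of c] z(1) by (simp add: K_def)
      moreover have "F (fibre_scale r z) = r * F z"
        using F z(4) r unfolding finsler_function_def slit_bundle_def by blast
      ultimately show ?thesis using z(3) by (simp add: f_def)
    qed
    have euler: "fd f w (0, snd w) = f w" if w: "w \<in> ?\<Omega>" for w
    proof -
      have "fst w \<in> U" "snd w \<noteq> 0" using w by (simp_all add: mem_Times_iff)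
      from euler_relation[of f "fst w" "snd w", OF _ hom[OF this]] show ?thesis
        using smooth_on_differentiable[OF f w] by simp
    qed
    have "fd (\<lambda>w. fd f w (0, axis l 1)) w (snd w, twisted_force i j k w) = fd f w (axis l 1, 0)" if w: "w \<in> ?\<Omega>" for w l
    proof -
      obtain z where z: "z \<in> fst K" "w = snd K z" "chart_inv K w = z" "z \<in> slit_bundle A" "fst z \<in> N"
        using point[OF w] by blast
      \<comment> \<open>Only the number \<open>2 * P z\<close> enters: in
        \<open>rapcsak_from_energy\<close> the projective factor is a scalar at the single point
        \<open>w\<close>.\<close>
      have "local_rep S K w = (snd w, twisted_force i j k w) - (2 * P z) *\<^sub>R (0, snd w)"
        using P[OF z(4)] S0_eq[of z] z K by (simp add: local_rep_def liouville_def K_def)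
      moreover have "\<psi> (chart_inv c x) = 1" if "x \<in> U" for x using UN[OF that] N1(3) by blast
      note chart = geodesic_spray_chart[OF geo Fs c(1) U(1,2) \<psi> this, folded K_def, folded f_def, OF _ euler w]
      ultimately show ?thesis
        using rapcsak_from_energy[OF \<Omega>(1) w f _ euler _ chart] pos by (metis less_irrefl)
    qed
    from twisted_spray_not_variational[OF U(1,3) T f pos hom this] show False by blast
  qed
  then show ?thesis using S0 by blast
qed

end
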